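(* Let $GW_N$ be a generalized wheel with $k$ groups and $2n$ vertices. Then $GW_N$ cannot be partitioned into plane spanning double stars if and only if there are three families of $\frac{k-1}{2}$ consecutive groups, each of which contains at most $n-2$ vertices, such that each group belongs to at least one of the three families.
   Context: A geometric graph is a graph drawn in the plane whose vertices are points in general position and whose edges are straight-line segments; it is plane if no two edges share a point of their relative interiors. A partition of a graph is a set of edge-disjoint subgraphs whose union is the graph. A double star is a tree with at most two vertices of degree at least $2$; it is spanning if it contains all vertices. Let $k\ge 3$ be odd and $N=[n_1,\dots,n_k]$ with integers $n_i\ge 1$ and $\sum_i n_i$ odd. The generalized wheel $GW_N$ is the complete geometric graph on the point set consisting of a center point $v_0$ together with $k$ groups $\mathcal{G}_1,\dots,\mathcal{G}_k$ (in this circular order), where group $\mathcal{G}_i$ consists of $n_i$ points that are $\varepsilon$-close (for sufficiently small $\varepsilon>0$) to the $i$-th vertex of a regular $k$-gon centered at $v_0$, all points other than $v_0$ lie on the convex hull in convex position, and $v_0$ is the only interior point. Its number of vertices is $2n = 1+\sum_i n_i$. Group indices are taken modulo $k$; a family of $\frac{k-1}{2}$ consecutive groups is a set $\{\mathcal{G}_j,\mathcal{G}_{j+1},\dots,\mathcal{G}_{j+\frac{k-3}{2}}\}$. *)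

theory Defs
  imports "HOL-Analysis.Analysis"
begin

record 'v graph =
  verts :: "'v set"
  edges :: "'v set set"

definition wf_graph :: "'v graph \<Rightarrow> bool" where
  "wf_graph H \<longleftrightarrow> finite (verts H) \<and> (\<forall>e\<in>edges H. e \<subseteq> verts H \<and> card e = 2)"

definition complete_graph :: "'v set \<Rightarrow> 'v graph" where
  "complete_graph V = \<lparr>verts = V, edges = {e. e \<subseteq> V \<and> card e = 2}\<rparr>"

definition subgraph :: "'v graph \<Rightarrow> 'v graph \<Rightarrow> bool" where
  "subgraph H K \<longleftrightarrow> wf_graph H \<and> verts H \<subseteq> verts K \<and> edges H \<subseteq> edges K"

definition connected_graph :: "'v graph \<Rightarrow> bool" where
  "connected_graph H \<longleftrightarrow> verts H \<noteq> {} \<and>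
     (\<forall>u\<in>verts H. \<forall>v\<in>verts H. (\<lambda>x y. {x, y} \<in> edges H)\<^sup>*\<^sup>* u v)"

definition cycle_in :: "'v graph \<Rightarrow> 'v list \<Rightarrow> bool" where
  "cycle_in H vs \<longleftrightarrow> length vs \<ge> 3 \<and> distinct vs \<and>
     (\<forall>i<length vs. {vs ! i, vs ! (Suc i mod length vs)} \<in> edges H)"

definition tree :: "'v graph \<Rightarrow> bool" where
  "tree H \<longleftrightarrow> wf_graph H \<and> connected_graph H \<and> (\<nexists>vs. cycle_in H vs)"

definition degree :: "'v graph \<Rightarrow> 'v \<Rightarrow> nat" where
  "degree H v = card {e \<in> edges H. v \<in> e}"

definition double_star :: "'v graph \<Rightarrow> bool" where
  "double_star H \<longleftrightarrow> tree H \<and> card {v \<in> verts H. degree H v \<ge> 2} \<le> 2"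

definition graph_partition :: "'v graph \<Rightarrow> 'v graph set \<Rightarrow> bool" where
  "graph_partition K S \<longleftrightarrow>
     (\<forall>H\<in>S. subgraph H K) \<and>
     pairwise (\<lambda>H H'. edges H \<inter> edges H' = {}) S \<and>
     (\<Union>H\<in>S. verts H) = verts K \<and> (\<Union>H\<in>S. edges H) = edges K"

text \<open>
  The plane is the type \<^typ>\<open>complex\<close>.  A geometric graph is a graph on points of the
  plane, and the edge between \<open>p\<close> and \<open>q\<close> is drawn as the segment \<open>convex hull {p, q}\<close>.
\<close>

definition plane_graph :: "complex graph \<Rightarrow> bool" where
  "plane_graph H \<longleftrightarrow> (\<forall>e\<in>edges H. \<forall>f\<in>edges H. e \<noteq> f \<longrightarrow>
     rel_interior (convex hull e) \<inter> rel_interior (convex hull f) = {})"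

definition partitionable_into_plane_spanning_double_stars :: "complex graph \<Rightarrow> bool" where
  "partitionable_into_plane_spanning_double_stars K \<longleftrightarrow>
     (\<exists>S. graph_partition K S \<and>
          (\<forall>H\<in>S. plane_graph H \<and> verts H = verts K \<and> double_star H))"

definition general_position :: "complex set \<Rightarrow> bool" where
  "general_position P \<longleftrightarrow> (\<forall>T\<subseteq>P. card T = 3 \<longrightarrow> \<not> collinear T)"

definition convex_position :: "complex set \<Rightarrow> bool" where
  "convex_position P \<longleftrightarrow> (\<forall>p\<in>P. p \<notin> convex hull (P - {p}))"

text \<open>
  \<open>wheel_groups N v0 r \<theta> \<epsilon> G\<close>: the sets \<open>G 0, \<dots>, G (k - 1)\<close>, where \<open>k = length N\<close>, are
  admissible groups around the center \<open>v0\<close>.  The regular \<open>k\<close>-gon has circumradius \<open>r\<close> and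
  is rotated by \<open>\<theta>\<close>; its vertices are numbered counterclockwise from \<open>0\<close>.
\<close>

definition wheel_groups ::
    "nat list \<Rightarrow> complex \<Rightarrow> real \<Rightarrow> real \<Rightarrow> real \<Rightarrow> (nat \<Rightarrow> complex set) \<Rightarrow> bool" where
  "wheel_groups N v0 r \<theta> \<epsilon> G \<longleftrightarrow>
     (let k = length N; Q = (\<Union>i<k. G i); P = insert v0 Q in
        (\<forall>i<k. finite (G i) \<and> card (G i) = N ! i \<and>
               (\<forall>p\<in>G i. dist p (v0 + of_real r * cis (\<theta> + 2 * pi * real i / real k)) < \<epsilon>)) \<and>
        disjoint_family_on G {..<k} \<and> v0 \<notin> Q \<and>
        general_position P \<and> convex_position Q \<and>
        P \<inter> interior (convex hull P) = {v0})"

definition generalized_wheel ::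
    "nat list \<Rightarrow> complex \<Rightarrow> real \<Rightarrow> real \<Rightarrow> real \<Rightarrow> complex graph \<Rightarrow> bool" where
  "generalized_wheel N v0 r \<theta> \<epsilon> K \<longleftrightarrow>
     (\<exists>G. wheel_groups N v0 r \<theta> \<epsilon> G \<and>
          K = complete_graph (insert v0 (\<Union>i<length N. G i)))"

text \<open>Families of groups are represented by the sets of indices of their groups.\<close>

definition consecutive_family :: "nat \<Rightarrow> nat set \<Rightarrow> bool" where
  "consecutive_family k F \<longleftrightarrow> (\<exists>j<k. F = {(j + i) mod k | i. i < (k - 1) div 2})"

end

(*
  Index the hull points q_0, ..., q_(2n-2) counterclockwise around v0, cyclically, and call i narrow
  if q_i, ..., q_(i+n) lie in an open half plane bounded by a line through v0, i.e. span an angle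
  below pi.  The wheel is partitionable if and only if some n cyclically consecutive indices are all
  not narrow.

  Necessity: a spanning double star has a spine edge such that every other vertex is adjacent to
  exactly one of its ends, and in a partition the n spines form a perfect matching.  For spines aa'
  and cc', the edges ac and a'c' lie in one tree and ac' and a'c in the other, so neither pair
  crosses.  Hence spines on the hull pairwise cross: if v0 is matched to q_0, then q_i is matched to
  q_(i+n-1), and each narrow j < n produces a crossing.  Sufficiency: with these spines, q_i takes
  the edges to the next n-1 hull points.

  For small epsilon, i is narrow iff the group of q_(i+n) is at most (k-1)/2 groups after that of
  q_i.  In that case the (k-1)/2 groups before the group of q_i contain at most n-2 points, and
  every such small family arises in this way.  All windows of length n contain a narrow index iff
  the small families cover all groups, and three of them suffice by a greedy choice.
*)

theory Submission
  imports Defs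
begin

text \<open>Two chords between hull points cross or not according to cyclic order alone; only edges
  at \<open>v0\<close> depend on the actual angles, and only through the question whether an arc
  exceeds pi. This is why \<open>narrow\<close> is the single geometric quantity that survives.
  Convex position and the inner position of \<open>v0\<close> enter through one condition,
  \<open>q_outside\<close>. Angles are unrolled to an increasing function on the naturals, so that
  cyclic arguments become arithmetic. The matching rests on two counts. Each tree has 2n-1 of the
  n(2n-1) edges, hence there are n trees; and a vertex outside every spine would be a leaf in each
  of the n trees, although it has 2n-1 > n edges. The bound n-2 is a complement: the n+1 points of a
  narrow run occupy at most (k-1)/2 + 1 consecutive groups, so the other (k-1)/2 groups share at
  most (2n-1) - (n+1) points.\<close>

section \<open>Orientation and crossing of segments\<close>

text \<open>Twice the signed area of the triangle \<open>a b c\<close>, positive when it is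
  traversed counterclockwise.\<close>

definition orient :: "complex \<Rightarrow> complex \<Rightarrow> complex \<Rightarrow> real" where
  "orient a b c = Im (cnj (b - a) * (c - a))"

lemma orient_coord:
  "orient a b c = (Re b - Re a) * (Im c - Im a) - (Im b - Im a) * (Re c - Re a)"
  by (simp add: orient_def algebra_simps)

lemma orient_rotate: "orient a b c = orient b c a"
  by (simp add: orient_coord algebra_simps)

lemma orient_swap: "orient a b c = - orient b a c"
  by (simp add: orient_coord algebra_simps)

lemma orient_degenerate [simp]: "orient a b a = 0" "orient a b b = 0" "orient a a b = 0"
  by (simp_all add: orient_coord)

lemma orient_affine:
  "orient a b ((1 - t) *\<^sub>R c + t *\<^sub>R d) = (1 - t) * orient a b c + t * orient a b d"
  by (simp add: orient_coord algebra_simps)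

definition crossing :: "complex set \<Rightarrow> complex set \<Rightarrow> bool" where
  "crossing e f \<longleftrightarrow> rel_interior (convex hull e) \<inter> rel_interior (convex hull f) \<noteq> {}"

lemma crossing_commute: "crossing e f \<longleftrightarrow> crossing f e"
  by (auto simp: crossing_def)

lemma rel_interior_edge: "a \<noteq> b \<Longrightarrow> rel_interior (convex hull {a, b}) = open_segment a (b :: complex)"
  by (metis rel_interior_closed_segment segment_convex_hull)

lemma crossing_segments:
  assumes "a \<noteq> b" "c \<noteq> d"
  shows "crossing {a, b} {c, d} \<longleftrightarrow> open_segment a b \<inter> open_segment c d \<noteq> {}"
  using assms by (simp add: crossing_def rel_interior_edge)

text \<open>Each segment has its endpoints strictly on different sides of the other line; the common
  point is computed explicitly, once on each segment.\<close>

lemma crossingI: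
  assumes "orient a b c * orient a b d < 0" "orient c d a * orient c d b < 0"
  shows "crossing {a, b} {c, d}"
proof -
  have ne: "a \<noteq> b" "c \<noteq> d" using assms by auto
  \<comment> \<open>By \<open>orient_affine\<close>, \<open>orient a b\<close> is affine along the
    segment from \<open>c\<close> to \<open>d\<close>; \<open>t\<close> is its zero. The parameter
    \<open>s\<close> is the zero of \<open>orient c d\<close> between \<open>a\<close> and
    \<open>b\<close>.\<close>
  define t where "t = orient a b c / (orient a b c - orient a b d)"
  define s where "s = orient c d a / (orient c d a - orient c d b)"
  have frac: "0 < x / (x - y) \<and> x / (x - y) < 1" if "x * y < 0" for x y :: real
    using that by (auto simp: mult_less_0_iff divide_simps)
  have t: "0 < t" "t < 1" and s: "0 < s" "s < 1"
    using frac[OF assms(1)] frac[OF assms(2)] by (auto simp: t_def s_def)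
  \<comment> \<open>The cross product of the two directions. After multiplication by
    \<open>W\<close> the equality of the two points is a polynomial identity in the
    coordinates.\<close>
  define W where "W = (Re b - Re a) * (Im d - Im c) - (Im b - Im a) * (Re d - Re c)"
  have W1: "orient a b c - orient a b d = - W" and W2: "orient c d a - orient c d b = W"
    by (simp_all add: W_def orient_coord algebra_simps)
  have W0: "W \<noteq> 0" using assms W1 by (auto simp: mult_less_0_iff)
  have tW: "t * W = - orient a b c" and sW: "s * W = orient c d a"
    using W0 by (simp_all add: t_def s_def W1 W2)
  have "W * Re ((1 - s) *\<^sub>R a + s *\<^sub>R b) = W * Re a + (s * W) * (Re b - Re a)"
    by (simp add: algebra_simps)
  also have "\<dots> = W * Re c + (t * W) * (Re d - Re c)"
    unfolding sW tW by (simp add: W_def orient_coord algebra_simps)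
  also have "\<dots> = W * Re ((1 - t) *\<^sub>R c + t *\<^sub>R d)" by (simp add: algebra_simps)
  finally have re: "Re ((1 - s) *\<^sub>R a + s *\<^sub>R b) = Re ((1 - t) *\<^sub>R c + t *\<^sub>R d)"
    using W0 by (metis mult_cancel_left)
  have "W * Im ((1 - s) *\<^sub>R a + s *\<^sub>R b) = W * Im a + (s * W) * (Im b - Im a)"
    by (simp add: algebra_simps)
  also have "\<dots> = W * Im c + (t * W) * (Im d - Im c)"
    unfolding sW tW by (simp add: W_def orient_coord algebra_simps)
  also have "\<dots> = W * Im ((1 - t) *\<^sub>R c + t *\<^sub>R d)" by (simp add: algebra_simps)
  finally have im: "Im ((1 - s) *\<^sub>R a + s *\<^sub>R b) = Im ((1 - t) *\<^sub>R c + t *\<^sub>R d)"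
    using W0 by (metis mult_cancel_left)
  have "(1 - s) *\<^sub>R a + s *\<^sub>R b = (1 - t) *\<^sub>R c + t *\<^sub>R d"
    using re im by (simp add: complex_eq_iff)
  moreover have "(1 - s) *\<^sub>R a + s *\<^sub>R b \<in> open_segment a b"
    using s ne by (auto simp: in_segment)
  moreover have "(1 - t) *\<^sub>R c + t *\<^sub>R d \<in> open_segment c d"
    using t ne by (auto simp: in_segment)
  ultimately show ?thesis unfolding crossing_segments[OF ne] by auto
qed

text \<open>\<open>orient a b\<close> vanishes on the first segment, but an inner point of the
  second one averages two nonnegative values, not both zero, with positive weights. One zero is
  allowed so that segments with a common endpoint are covered.\<close>

lemma not_crossingI:
  assumes "c \<noteq> d" "orient a b c \<ge> 0" "orient a b d \<ge> 0" "orient a b c > 0 \<or> orient a b d > 0"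
  shows "\<not> crossing {a, b} {c, d}"
proof
  assume "crossing {a, b} {c, d}"
  moreover have "a \<noteq> b" using assms by auto
  ultimately obtain p where "p \<in> open_segment a b" "p \<in> open_segment c d"
    unfolding crossing_segments[OF \<open>a \<noteq> b\<close> assms(1)] by blast
  then obtain s t where s: "p = (1 - s) *\<^sub>R a + s *\<^sub>R b"
    and t: "0 < t" "t < 1" "p = (1 - t) *\<^sub>R c + t *\<^sub>R d"
    unfolding in_segment by blast
  have "(1 - t) * orient a b c + t * orient a b d = 0"
    using orient_affine[of a b s a b] orient_affine[of a b t c d] s t by simp
  moreover have "(1 - t) * orient a b c + t * orient a b d > 0"
    using assms t by (smt (verit) mult_nonneg_nonneg mult_pos_pos)
  ultimately show False by simp
qed

text \<open>The anti-exchange property of convex hulls. Inserting one representation into the other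
  expresses a positive multiple of \<open>p\<close> by two points of \<open>convex hull A\<close>.
  It later removes the center from a hull.\<close>

lemma convex_hull_anti_exchange:
  fixes x p :: "'a :: real_vector"
  assumes x: "x \<in> convex hull (insert p A)" and p: "p \<in> convex hull (insert x A)" and "x \<noteq> p"
  shows "p \<in> convex hull A"
proof -
  have A: "A \<noteq> {}" using assms by auto
  obtain u a where u: "0 \<le> u" "u \<le> 1" "a \<in> convex hull A" "x = (1 - u) *\<^sub>R p + u *\<^sub>R a"
    using x using A unfolding convex_hull_insert_alt by auto
  obtain w b where w: "0 \<le> w" "w \<le> 1" "b \<in> convex hull A" "p = (1 - w) *\<^sub>R x + w *\<^sub>R b"
    using p using A unfolding convex_hull_insert_alt by auto
  \<comment> \<open>This is 1 - (1-u)(1-w), what remains of the coefficient of \<open>p\<close>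
    after substitution. It vanishes only if \<open>u = w = 0\<close>, and \<open>u = 0\<close> would
    mean \<open>x = p\<close>.\<close>
  define z where "z = u + w - u * w"
  have zp: "z > 0"
  proof -
    have "u \<noteq> 0" using u(4) \<open>x \<noteq> p\<close> by auto
    moreover have "w * (1 - u) \<ge> 0" using u w by simp
    ultimately show ?thesis using u(1) by (simp add: z_def algebra_simps)
  qed
  have "p = (1 - w) *\<^sub>R ((1 - u) *\<^sub>R p + u *\<^sub>R a) + w *\<^sub>R b"
    using u(4) w(4) by simp
  then have "p = p - z *\<^sub>R p + (((1 - w) * u) *\<^sub>R a + w *\<^sub>R b)"
    unfolding z_def by (simp add: algebra_simps)
  then have "z *\<^sub>R p = ((1 - w) * u) *\<^sub>R a + w *\<^sub>R b"
    by (simp add: algebra_simps)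
  from arg_cong[OF this, of "\<lambda>v. inverse z *\<^sub>R v"] have eq: "p = ((1 - w) * u / z) *\<^sub>R a + (w / z) *\<^sub>R b"
    using zp by (simp add: scaleR_add_right divide_inverse mult.commute)
  have "((1 - w) * u / z) *\<^sub>R a + (w / z) *\<^sub>R b \<in> convex hull A"
  proof (rule convexD[OF convex_convex_hull u(3) w(3)])
    show "0 \<le> (1 - w) * u / z" "0 \<le> w / z" using u w zp by auto
    have "(1 - w) * u + w = z" by (simp add: z_def algebra_simps)
    then show "(1 - w) * u / z + w / z = 1" using zp by (simp add: add_divide_distrib[symmetric])
  qed
  then show ?thesis using eq by simp
qed

section \<open>Points indexed by angle\<close>

lemma not_crossing_same_side:
  assumes "c \<noteq> d"
    and "(orient a b c \<ge> 0 \<and> orient a b d \<ge> 0 \<or> orient a b c \<le> 0 \<and> orient a b d \<le> 0)"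
    and "orient a b c \<noteq> 0 \<or> orient a b d \<noteq> 0"
  shows "\<not> crossing {a, b} {c, d}"
proof (cases "orient a b c \<ge> 0 \<and> orient a b d \<ge> 0")
  case True
  then show ?thesis using assms by (intro not_crossingI) auto
next
  case False
  then have "\<not> crossing {b, a} {c, d}"
    using assms by (intro not_crossingI) (auto simp: orient_swap[of b a])
  then show ?thesis by (simp add: insert_commute)
qed

text \<open>
  The points of \<open>q\<close> are indexed counterclockwise around \<open>v0\<close>, periodically with period \<open>L\<close>;
  \<open>phi\<close> is the polar angle without reduction modulo \<open>2\<pi>\<close>, so it increases by \<open>2\<pi>\<close> in each turn.
\<close>

locale cyclic_points =
  fixes v0 :: complex and q :: "nat \<Rightarrow> complex" and phi rho :: "nat \<Rightarrow> real" and n L :: nat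
  assumes n2: "n \<ge> 2" and L: "L + 1 = 2 * n"
    and q_per: "q (i + L) = q i"
    and phi_per: "phi (i + L) = phi i + 2 * pi"
    and phi_mono: "i < j \<Longrightarrow> phi i < phi j"
    and polar: "q i = v0 + of_real (rho i) * cis (phi i)"
    and rho_pos: "rho i > 0"
    and phi_ne_pi: "phi j - phi i \<noteq> pi"
    and q_outside: "i < j \<Longrightarrow> j < k \<Longrightarrow> k < i + L \<Longrightarrow> q j \<notin> convex hull {v0, q i, q k}"
begin

lemma orient_center: "orient v0 (q i) (q j) = rho i * rho j * sin (phi j - phi i)"
  by (simp add: orient_coord polar[of i] polar[of j] sin_diff algebra_simps)

lemma orient_center_pos:
  assumes "i < j" "phi j - phi i < pi"
  shows "orient v0 (q i) (q j) > 0"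
  using assms phi_mono[of i j] rho_pos by (simp add: orient_center sin_gt_zero)

lemma orient_center_neg:
  assumes "j < i + L" "phi j - phi i > pi"
  shows "orient v0 (q i) (q j) < 0"
proof -
  have "phi j - phi i < 2 * pi" using phi_mono[OF assms(1)] phi_per[of i] by simp
  then have "sin (phi j - phi i) < 0" using assms by (intro sin_lt_zero) auto
  then show ?thesis using rho_pos[of i] rho_pos[of j] by (simp add: orient_center mult_pos_neg)
qed

lemma orient_center_ne:
  assumes "i < j" "j < i + L"
  shows "orient v0 (q i) (q j) \<noteq> 0"
  using orient_center_pos[of i j] orient_center_neg[of j i] phi_ne_pi[of j i] assms
  by (metis less_irrefl linorder_neqE_linordered_idom)

lemma q_ne_center: "q i \<noteq> v0" "v0 \<noteq> q i"
  using polar[of i] rho_pos[of i] by auto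

lemma q_ne:
  assumes "i < j" "j < i + L"
  shows "q i \<noteq> q j" "q j \<noteq> q i"
  using orient_center_ne[OF assms] by auto

text \<open>The three points lie in a half plane at \<open>v0\<close>, so Cramer's rule writes
  \<open>q j - v0\<close> as a nonnegative combination of \<open>q i - v0\<close> and
  \<open>q k - v0\<close>. A wrong orientation would make the coefficient sum at most 1 and put
  \<open>q j\<close> into the triangle that \<open>q_outside\<close> forbids.\<close>

lemma orient_pos_aux:
  assumes "i < j" "j < k" "k < i + L" and "phi k - phi i < pi"
  shows "orient (q i) (q j) (q k) > 0"
proof -
  define X where "X = (\<lambda>i j. orient v0 (q i) (q j))"
  have pos: "X i k > 0" "X i j > 0" "X j k > 0"
    using assms phi_mono[of i j] phi_mono[of j k] unfolding X_def
    by (auto intro!: orient_center_pos)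
  have eq: "orient (q i) (q j) (q k) = X i j + X j k - X i k"
    by (simp add: X_def orient_coord algebra_simps)
  show ?thesis
  proof (rule ccontr)
    assume "\<not> ?thesis"
    then have le: "X i j + X j k \<le> X i k" using eq by simp
    have cramer: "X i k *\<^sub>R (q j - v0) = X j k *\<^sub>R (q i - v0) + X i j *\<^sub>R (q k - v0)"
      by (simp add: complex_eq_iff X_def orient_coord algebra_simps)
    define b c where "b = X j k / X i k" and "c = X i j / X i k"
    have "q j - v0 = b *\<^sub>R (q i - v0) + c *\<^sub>R (q k - v0)"
      using arg_cong[OF cramer, of "\<lambda>v. inverse (X i k) *\<^sub>R v"] pos
      by (simp add: b_def c_def scaleR_add_right divide_inverse mult.commute)
    then have "q j = (1 - b - c) *\<^sub>R v0 + b *\<^sub>R q i + c *\<^sub>R q k"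
      by (simp add: algebra_simps)
    moreover have "b \<ge> 0" "c \<ge> 0" "1 - b - c \<ge> 0" "(1 - b - c) + b + c = 1"
    proof -
      show "b \<ge> 0" "c \<ge> 0" using pos by (auto simp: b_def c_def)
      have "b + c = (X i j + X j k) / X i k" by (simp add: b_def c_def add_divide_distrib)
      also have "\<dots> \<le> 1" using le pos by simp
      finally show "1 - b - c \<ge> 0" by simp
    qed simp
    ultimately have "q j \<in> convex hull {v0, q i, q k}"
      unfolding convex_hull_3 by blast
    then show False using q_outside assms by blast
  qed
qed

text \<open>If one of the three gaps between the points exceeds pi, the other two add up to less
  than pi, and \<open>orient_pos_aux\<close> applies after a cyclic rotation. If all gaps are below
  pi, the area is the sum of the three positive areas seen from \<open>v0\<close>.\<close>

lemma orient_pos: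
  assumes "i < j" "j < k" "k < i + L"
  shows "orient (q i) (q j) (q k) > 0"
proof -
  have per: "phi (i + L) = phi i + 2 * pi" "phi (j + L) = phi j + 2 * pi"
    "q (i + L) = q i" "q (j + L) = q j"
    using phi_per q_per by auto
  consider "phi j - phi i > pi" | "phi k - phi j > pi" | "phi (i + L) - phi k > pi"
    | "phi j - phi i < pi" "phi k - phi j < pi" "phi (i + L) - phi k < pi"
    using phi_ne_pi by (metis linorder_neqE_linordered_idom)
  then show ?thesis
  proof cases
    case 1
    then have "orient (q j) (q k) (q (i + L)) > 0"
      using assms per by (intro orient_pos_aux) auto
    then show ?thesis using per by (metis orient_rotate)
  next
    case 2
    then have "orient (q k) (q (i + L)) (q (j + L)) > 0"
      using assms per by (intro orient_pos_aux) auto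
    then show ?thesis using per by (metis orient_rotate)
  next
    case 3
    then show ?thesis using assms per by (intro orient_pos_aux) auto
  next
    case 4
    have "orient (q i) (q j) (q k) =
        orient v0 (q i) (q j) + orient v0 (q j) (q k) + orient v0 (q k) (q (i + L))"
      using per by (simp add: orient_coord algebra_simps)
    moreover have "orient v0 (q i) (q j) > 0" "orient v0 (q j) (q k) > 0"
      "orient v0 (q k) (q (i + L)) > 0"
      using 4 assms by (auto intro: orient_center_pos)
    ultimately show ?thesis by simp
  qed
qed

lemma crossing_hull:
  assumes "a < b" "b < c" "c < d" "d < a + L"
  shows "crossing {q a, q c} {q b, q d}"
proof (rule crossingI)
  have "orient (q a) (q b) (q c) > 0" "orient (q a) (q c) (q d) > 0"
    "orient (q a) (q b) (q d) > 0" "orient (q b) (q c) (q d) > 0"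
    using assms by (auto intro!: orient_pos)
  moreover have "orient (q a) (q c) (q b) = - orient (q a) (q b) (q c)"
    "orient (q b) (q d) (q a) = orient (q a) (q b) (q d)"
    "orient (q b) (q d) (q c) = - orient (q b) (q c) (q d)"
    by (simp_all add: orient_coord algebra_simps)
  ultimately show "orient (q a) (q c) (q b) * orient (q a) (q c) (q d) < 0"
    "orient (q b) (q d) (q a) * orient (q b) (q d) (q c) < 0"
    by (simp_all add: mult_less_0_iff)
qed

text \<open>For an arc below pi, the chord passes between \<open>v0\<close> and the points of the
  arc; \<open>not_crossing_center\<close> is the opposite case, where \<open>v0\<close> and
  \<open>q b\<close> lie on the same side of the chord.\<close>

lemma crossing_center:
  assumes "a < b" "b < c" "phi c - phi a < pi"
  shows "crossing {v0, q b} {q a, q c}"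
proof (rule crossingI)
  have "c < a + L"
    using assms(3) phi_per[of a] phi_mono[of "a + L" c]
    by (smt (verit) linorder_neqE_nat pi_gt_zero)
  then have "orient (q a) (q b) (q c) > 0" "orient v0 (q a) (q b) > 0" "orient v0 (q b) (q c) > 0"
    "orient v0 (q a) (q c) > 0"
    using assms phi_mono[of a b] phi_mono[of b c] by (auto intro!: orient_pos orient_center_pos)
  moreover have "orient v0 (q b) (q a) = - orient v0 (q a) (q b)"
    "orient (q a) (q c) v0 = orient v0 (q a) (q c)"
    "orient (q a) (q c) (q b) = - orient (q a) (q b) (q c)"
    by (simp_all add: orient_coord algebra_simps)
  ultimately show "orient v0 (q b) (q a) * orient v0 (q b) (q c) < 0"
    "orient (q a) (q c) v0 * orient (q a) (q c) (q b) < 0"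
    by (simp_all add: mult_less_0_iff)
qed

text \<open>The equalities \<open>b = c\<close> and \<open>d = a + L\<close> admit chords with a
  common endpoint; both at once would make the two chords equal.\<close>

lemma not_crossing_hull:
  assumes "a < b" "b \<le> c" "c < d" "d \<le> a + L" "b \<noteq> c \<or> d \<noteq> a + L"
  shows "\<not> crossing {q a, q b} {q c, q d}"
proof (rule not_crossing_same_side)
  have per: "q (a + L) = q a" by (rule q_per)
  have c: "b \<noteq> c \<Longrightarrow> orient (q a) (q b) (q c) > 0" 
    and d: "d \<noteq> a + L \<Longrightarrow> orient (q a) (q b) (q d) > 0"
    using assms by (auto intro!: orient_pos)
  then show "orient (q a) (q b) (q c) \<ge> 0 \<and> orient (q a) (q b) (q d) \<ge> 0 \<or>
      orient (q a) (q b) (q c) \<le> 0 \<and> orient (q a) (q b) (q d) \<le> 0"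
    using per by (cases "b = c"; cases "d = a + L") auto
  show "orient (q a) (q b) (q c) \<noteq> 0 \<or> orient (q a) (q b) (q d) \<noteq> 0"
    using c d assms by fastforce
  show "q c \<noteq> q d" using assms by (intro q_ne) auto
qed

lemma not_crossing_center_edges:
  assumes "a < b" "b < a + L"
  shows "\<not> crossing {v0, q a} {v0, q b}"
  using orient_center_ne[OF assms] q_ne_center[of b]
  by (intro not_crossing_same_side) (auto simp: linear)

lemma not_crossing_adjacent:
  assumes "a < b" "b < a + L"
  shows "\<not> crossing {v0, q a} {q a, q b}" "\<not> crossing {v0, q b} {q a, q b}"
proof -
  have *: "\<not> crossing {v0, q a} {q a, q b}" if "a < b" "b < a + L" for a b
    using orient_center_ne[OF that] q_ne[OF that] 
    by (intro not_crossing_same_side) (auto simp: linear)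
  show "\<not> crossing {v0, q a} {q a, q b}" using * assms .
  show "\<not> crossing {v0, q b} {q a, q b}"
    using *[of b "a + L"] q_per[of a] assms by (simp add: insert_commute)
qed

lemma not_crossing_center:
  assumes "a < b" "b < c" "c < a + L" "phi c - phi a > pi"
  shows "\<not> crossing {v0, q b} {q a, q c}"
proof -
  have "orient (q a) (q b) (q c) > 0" "orient v0 (q a) (q c) < 0"
    using assms by (auto intro: orient_pos orient_center_neg)
  moreover have "orient (q a) (q c) v0 = orient v0 (q a) (q c)"
    "orient (q a) (q c) (q b) = - orient (q a) (q b) (q c)"
    by (simp_all add: orient_coord algebra_simps)
  ultimately have "\<not> crossing {q a, q c} {v0, q b}"
    using q_ne_center[of b] by (intro not_crossing_same_side) auto
  then show ?thesis by (simp add: crossing_commute)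
qed

lemma q_inj: "i < L \<Longrightarrow> j < L \<Longrightarrow> q i = q j \<Longrightarrow> i = j"
  using q_ne[of i j] q_ne[of j i] by (metis linorder_neqE_nat trans_less_add2)

lemma q_add_mult: "q (j + L * m) = q j"
proof (induction m)
  case (Suc m)
  then show ?case using q_per[of "j + L * m"] by (simp add: ac_simps)
qed simp

lemma q_mod: "q (i mod L) = q i"
  using q_add_mult[of "i mod L" "i div L"] by simp

definition narrow :: "nat \<Rightarrow> bool" where
  "narrow j \<longleftrightarrow> phi (j + n) - phi j < pi"

text \<open>Rotating the numbering lets both directions of the criterion assume that the window
  starts at index 0.\<close>

lemma cyclic_points_shift: "cyclic_points v0 (\<lambda>i. q (i + x)) (\<lambda>i. phi (i + x)) (\<lambda>i. rho (i + x)) n L"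
proof (unfold_locales, goal_cases)
  case (3 i)
  then show ?case using q_per[of "i + x"] by (simp add: ac_simps)
next
  case (4 i)
  then show ?case using phi_per[of "i + x"] by (simp add: ac_simps)
next
  case (9 i j k)
  then show ?case using q_outside[of "i + x" "j + x" "k + x"] by simp
qed (use n2 L phi_mono polar rho_pos phi_ne_pi in auto)

end

section \<open>Spines of double stars\<close>

text \<open>A star fits as well, with any leaf as the second end, so a tree may have several
  spines.\<close>

definition spine :: "'v graph \<Rightarrow> 'v \<Rightarrow> 'v \<Rightarrow> bool" where
  "spine H a b \<longleftrightarrow> a \<noteq> b \<and> a \<in> verts H \<and> b \<in> verts H \<and> {a, b} \<in> edges H \<and>
     (\<forall>e\<in>edges H. a \<in> e \<or> b \<in> e) \<and>
     (\<forall>v\<in>verts H - {a, b}. {a, v} \<in> edges H \<longleftrightarrow> {b, v} \<notin> edges H)"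

lemma spine_commute: "spine H a b \<longleftrightarrow> spine H b a"
  by (auto simp: spine_def insert_commute)

lemma wf_edge_cases:
  assumes "wf_graph H" "e \<in> edges H" "v \<in> e"
  obtains w where "e = {v, w}" "w \<noteq> v" "v \<in> verts H" "w \<in> verts H"
proof -
  have "card e = 2" "e \<subseteq> verts H" using assms by (auto simp: wf_graph_def)
  then show ?thesis using assms(3) that by (auto simp: card_2_iff)
qed

lemma finite_edges: "wf_graph H \<Longrightarrow> finite (edges H)"
  by (rule finite_subset[of _ "Pow (verts H)"]) (auto simp: wf_graph_def)

lemma connected_closed_set:
  assumes "connected_graph H" "A \<subseteq> verts H" "a \<in> A"
    and closed: "\<And>x y. x \<in> A \<Longrightarrow> {x, y} \<in> edges H \<Longrightarrow> y \<in> A"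
  shows "A = verts H"
proof -
  have "v \<in> A" if "v \<in> verts H" for v
  proof -
    have "(\<lambda>x y. {x, y} \<in> edges H)\<^sup>*\<^sup>* a v"
      using assms that by (auto simp: connected_graph_def)
    then show ?thesis
      by (induction rule: rtranclp_induct) (use assms(3) closed in auto)
  qed
  then show ?thesis using assms(2) by auto
qed

lemma degree_ge_2:
  assumes "wf_graph H" "{v, x} \<in> edges H" "{v, y} \<in> edges H" "x \<noteq> y"
  shows "degree H v \<ge> 2"
proof -
  have "card {{v, x}, {v, y}} = 2" using assms(4) by (auto simp: doubleton_eq_iff card_2_iff)
  moreover have "card {{v, x}, {v, y}} \<le> degree H v"
    unfolding degree_def using assms finite_edges[OF assms(1)] by (intro card_mono) auto
  ultimately show ?thesis by simp
qed

text \<open>Every edge meets the set \<open>B\<close> of vertices of degree at least 2, since an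
  edge between two leaves would be a whole component with only two vertices. If \<open>B\<close> is
  one vertex, the graph is a star and any neighbour serves as second end. If \<open>B\<close> has
  two vertices, they are the ends, and a vertex adjacent to both would itself belong to
  \<open>B\<close>.\<close>

lemma double_star_has_spine:
  assumes ds: "double_star H" and card: "card (verts H) \<ge> 3"
  obtains a b where "spine H a b"
proof -
  have wf: "wf_graph H" and conn: "connected_graph H"
    using ds by (auto simp: double_star_def tree_def)
  have fin: "finite (verts H)" using wf by (simp add: wf_graph_def)
  define B where "B = {v \<in> verts H. degree H v \<ge> 2}"
  have finB: "finite B" and cardB: "card B \<le> 2"
    using ds fin by (auto simp: B_def double_star_def)
  have two: "v \<in> B" if "{v, x} \<in> edges H" "{v, y} \<in> edges H" "x \<noteq> y" for v x y
  proof -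
    have "v \<in> verts H" using wf that by (auto simp: wf_graph_def)
    then show ?thesis using degree_ge_2[OF wf that] by (simp add: B_def)
  qed
  have nbr: "\<exists>w. {v, w} \<in> edges H" if v: "v \<in> verts H" for v
  proof (rule ccontr)
    assume "\<not> ?thesis"
    then have "{v} = verts H"
      using connected_closed_set[OF conn, of "{v}" v] v by auto
    then have "card (verts H) = card {v}" by simp
    then show False using card by simp
  qed
  have edgeB: "u \<in> B \<or> v \<in> B" if uv: "{u, v} \<in> edges H" for u v
  proof (rule ccontr)
    assume no: "\<not> ?thesis"
    have "{u, v} = verts H"
    proof (rule connected_closed_set[OF conn, of _ u])
      show "{u, v} \<subseteq> verts H" using wf uv by (auto simp: wf_graph_def)
      have vu: "{v, u} \<in> edges H" using uv by (simp add: insert_commute)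
      show "y \<in> {u, v}" if "x \<in> {u, v}" "{x, y} \<in> edges H" for x y
        using that no two[OF uv, of y] two[OF vu, of y] by auto
    qed simp
    moreover have "card {u, v} \<le> 2" by (simp add: card_insert_if)
    ultimately show False using card by simp
  qed
  have edgeB': "e \<inter> B \<noteq> {}" if e: "e \<in> edges H" for e
  proof -
    have "card e = 2" using wf e by (auto simp: wf_graph_def)
    then obtain u v where "e = {u, v}" by (auto simp: card_2_iff)
    then show ?thesis using edgeB e by auto
  qed
  have "verts H \<noteq> {}" using card by auto
  then obtain v0 where "v0 \<in> verts H" by auto
  then obtain w0 where "{v0, w0} \<in> edges H" using nbr by auto
  then have "B \<noteq> {}" using edgeB by auto
  then have "card B \<noteq> 0" using finB by auto
  then have "card B = 1 \<or> card B = 2" using cardB by linarith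
  then show ?thesis
  proof
    assume "card B = 1"
    then obtain a where B: "B = {a}" by (auto simp: card_1_singleton_iff)
    have aV: "a \<in> verts H" using B by (auto simp: B_def)
    then obtain b where ab: "{a, b} \<in> edges H" using nbr by auto
    have bV: "b \<in> verts H" and ne: "a \<noteq> b" using wf ab by (auto simp: wf_graph_def)
    have av: "{a, v} \<in> edges H" if v: "v \<in> verts H" "v \<noteq> a" for v
    proof -
      obtain w where w: "{v, w} \<in> edges H" using nbr v by auto
      then show ?thesis using edgeB[OF w] B v(2) by (auto simp: insert_commute)
    qed
    have "spine H a b"
      unfolding spine_def using aV bV ne ab av edgeB' B by fastforce
    then show ?thesis using that by blast
  next
    assume "card B = 2"
    then obtain a b where B: "B = {a, b}" and ne: "a \<noteq> b" by (auto simp: card_2_iff)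
    have V: "a \<in> verts H" "b \<in> verts H" using B by (auto simp: B_def)
    have ab: "{a, b} \<in> edges H"
    proof (rule ccontr)
      assume nab: "{a, b} \<notin> edges H"
      \<comment> \<open>Without the edge \<open>{a, b}\<close>, all neighbours of \<open>a\<close>
        are leaves, so the star at \<open>a\<close> would be a component that misses
        \<open>b\<close>.\<close>
      have "insert a {x. {a, x} \<in> edges H} = verts H"
      proof (rule connected_closed_set[OF conn, of _ a])
        show "insert a {x. {a, x} \<in> edges H} \<subseteq> verts H" 
          using wf V by (auto simp: wf_graph_def)
        fix x y assume x: "x \<in> insert a {x. {a, x} \<in> edges H}" and xy: "{x, y} \<in> edges H"
        show "y \<in> insert a {x. {a, x} \<in> edges H}"
        proof (cases "x = a")
          case False
          then have "x \<notin> B" using x nab B by auto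
          moreover have "{x, a} \<in> edges H" using x False by (auto simp: insert_commute)
          ultimately show ?thesis using two[OF xy] by auto
        qed (use xy in auto)
      qed simp
      then show False using V nab ne by auto
    qed
    have ex: "{a, v} \<in> edges H \<or> {b, v} \<in> edges H" if v: "v \<in> verts H - {a, b}" for v
    proof -
      obtain w where w: "{v, w} \<in> edges H" using nbr v by auto
      then show ?thesis using edgeB[OF w] B v by (auto simp: insert_commute)
    qed
    have nx: "\<not> ({a, v} \<in> edges H \<and> {b, v} \<in> edges H)" if v: "v \<in> verts H - {a, b}" for v
      using two[of v a b] v B ne by (auto simp: insert_commute)
    have "spine H a b"
      unfolding spine_def using V ne ab ex nx edgeB' B by fastforce
    then show ?thesis using that by blast
  qed
qed

lemma card_edges_spine:
  assumes wf: "wf_graph H" and sp: "spine H a b"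
  shows "card (edges H) + 1 = card (verts H)"
proof -
  \<comment> \<open>Every vertex other than \<open>a\<close> is charged with the edge that joins it
    to the spine; \<open>b\<close> is charged with the spine edge itself.\<close>
  define f where "f = (\<lambda>v. if v = b \<or> {a, v} \<in> edges H then {a, v} else {b, v})"
  have "bij_betw f (verts H - {a}) (edges H)"
    unfolding bij_betw_def
  proof
    show "inj_on f (verts H - {a})"
      by (rule inj_onI) (auto simp: f_def doubleton_eq_iff split: if_splits)
    show "f ` (verts H - {a}) = edges H"
    proof (intro equalityI subsetI)
      fix e assume "e \<in> f ` (verts H - {a})"
      then show "e \<in> edges H" using sp by (auto simp: f_def spine_def split: if_splits)
    next
      fix e assume e: "e \<in> edges H"
      show "e \<in> f ` (verts H - {a})"
      proof (cases "a \<in> e")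
        case True
        then obtain w where w: "e = {a, w}" "w \<noteq> a" "w \<in> verts H" using wf_edge_cases[OF wf e] by metis
        then have "f w = e" using e by (simp add: f_def)
        then show ?thesis using w by auto
      next
        case False
        then have "b \<in> e" using sp e by (auto simp: spine_def)
        then obtain w where w: "e = {b, w}" "w \<noteq> b" "w \<in> verts H" using wf_edge_cases[OF wf e] by metis
        then have "f w = e" using False sp e by (auto simp: f_def spine_def)
        then show ?thesis using w False by auto
      qed
    qed
  qed
  then have "card (edges H) = card (verts H - {a})" by (simp add: bij_betw_same_card)
  moreover have "a \<in> verts H" "finite (verts H)" using sp wf by (auto simp: spine_def wf_graph_def)
  ultimately show ?thesis
    by (metis Suc_eq_plus1 card.remove)
qed

text \<open>A vertex outside \<open>{a, b}\<close> has the single neighbour \<open>f v\<close>.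
  Hence it lies on no cycle, and a cycle inside \<open>{a, b}\<close> would be too short.\<close>

lemma double_starI:
  assumes fin: "finite V" and ab: "a \<in> V" "b \<in> V" "a \<noteq> b"
    and f: "\<And>v. v \<in> V - {a, b} \<Longrightarrow> f v \<in> {a, b}"
    and H: "verts H = V" "edges H = insert {a, b} ((\<lambda>v. {f v, v}) ` (V - {a, b}))"
  shows "double_star H"
proof -
  have wf: "wf_graph H"
    unfolding wf_graph_def H using fin ab f by (auto simp: card_2_iff doubleton_eq_iff)
  define R where "R = (\<lambda>x y. {x, y} \<in> edges H)"
  have symR: "R y x" if "R x y" for x y using that by (simp add: R_def insert_commute)
  have toa: "R\<^sup>*\<^sup>* v a" if v: "v \<in> V" for v
  proof -
    have ba: "R b a" by (simp add: R_def H insert_commute)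
    consider "v = a" | "v = b" | "v \<in> V - {a, b}" using v by blast
    then show ?thesis
    proof cases
      case 3
      then have "R v (f v)" by (auto simp: R_def H insert_commute)
      moreover have "f v = a \<or> f v = b" using f 3 by auto
      ultimately show ?thesis using ba by (meson converse_rtranclp_into_rtranclp r_into_rtranclp)
    qed (use ba in auto)
  qed
  have conn: "connected_graph H"
    unfolding connected_graph_def
  proof (intro conjI ballI)
    show "verts H \<noteq> {}" using H ab by auto
    fix u v assume "u \<in> verts H" "v \<in> verts H"
    then have "R\<^sup>*\<^sup>* u a" "R\<^sup>*\<^sup>* v a" using toa H by auto
    moreover have "R\<^sup>*\<^sup>* a v"
      by (rule sympD[OF symp_rtranclp, rotated]) (use \<open>R\<^sup>*\<^sup>* v a\<close> symR in \<open>auto intro: sympI\<close>)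
    ultimately have "R\<^sup>*\<^sup>* u v" by simp
    then show "(\<lambda>x y. {x, y} \<in> edges H)\<^sup>*\<^sup>* u v"
      unfolding R_def .
  qed
  have leaf: "x = f v" if vx: "v \<notin> {a, b}" "{v, x} \<in> edges H" for v x
  proof -
    have "{v, x} \<noteq> {a, b}" using vx by (auto simp: doubleton_eq_iff)
    then obtain y where y: "y \<in> V - {a, b}" "{v, x} = {f y, y}" using vx by (auto simp: H)
    then have "v \<noteq> f y" using f[OF y(1)] vx by auto
    then show ?thesis using y(2) by (auto simp: doubleton_eq_iff)
  qed
  have acyc: "\<nexists>vs. cycle_in H vs"
  proof
    assume "\<exists>vs. cycle_in H vs"
    then obtain vs where len: "length vs \<ge> 3" and dist: "distinct vs"
      and ed: "\<And>i. i < length vs \<Longrightarrow> {vs ! i, vs ! (Suc i mod length vs)} \<in> edges H"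
      unfolding cycle_in_def by auto
    have "set vs \<subseteq> {a, b}"
    proof
      fix v assume "v \<in> set vs"
      then obtain i where i: "i < length vs" "v = vs ! i" by (auto simp: in_set_conv_nth)
      \<comment> \<open>The cyclic predecessor of \<open>i\<close>. As the cycle has length at least
        3, it differs from the successor, which gives \<open>v\<close> two distinct
        neighbours.\<close>
      define j where "j = (if i = 0 then length vs - 1 else i - 1)"
      have j: "j < length vs" "Suc j mod length vs = i" using i len by (auto simp: j_def)
      have ne: "Suc i mod length vs \<noteq> j" 
        using i len by (cases "Suc i = length vs") (auto simp: j_def)
      have "{v, vs ! (Suc i mod length vs)} \<in> edges H" using ed[OF i(1)] i(2) by simp
      moreover have "{v, vs ! j} \<in> edges H" using ed[OF j(1)] j i(2) by (simp add: insert_commute)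
      moreover have "vs ! (Suc i mod length vs) \<noteq> vs ! j"
        using ne j len nth_eq_iff_index_eq[OF dist, of "Suc i mod length vs" j]
          mod_less_divisor[of "length vs" "Suc i"] by fastforce
      ultimately show "v \<in> {a, b}" using leaf by metis
    qed
    then have "card (set vs) \<le> card {a, b}" by (intro card_mono) auto
    then show False using len dist ab by (simp add: distinct_card)
  qed
  have "{v \<in> verts H. degree H v \<ge> 2} \<subseteq> {a, b}"
  proof (rule ccontr)
    assume "\<not> ?thesis"
    then obtain v where v: "v \<in> V" "v \<notin> {a, b}" "degree H v \<ge> 2" using H by auto
    have "{e \<in> edges H. v \<in> e} \<subseteq> {{v, f v}}"
    proof
      fix e assume e: "e \<in> {e \<in> edges H. v \<in> e}"
      then obtain w where "e = {v, w}" using wf_edge_cases[OF wf] by blast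
      then show "e \<in> {{v, f v}}" using leaf[OF v(2), of w] e by auto
    qed
    then have "degree H v \<le> card {{v, f v}}" unfolding degree_def by (intro card_mono) auto
    then show False using v by simp
  qed
  then have "card {v \<in> verts H. degree H v \<ge> 2} \<le> card {a, b}" by (intro card_mono) auto
  also have "\<dots> \<le> 2" using ab by simp
  finally show ?thesis using wf conn acyc by (auto simp: double_star_def tree_def)
qed

section \<open>The window forced by a partition\<close>

text \<open>\<open>T v\<close> is the unique tree with \<open>v\<close> on its chosen spine, and
  \<open>mate v\<close> is the other end. An edge lies in the tree of one of its endpoints because
  it has to meet the spine of its tree.\<close>

lemma partition_spines:
  assumes part: "graph_partition (complete_graph V) S" and fin: "finite V"
    and card: "card V = 2 * n" and n: "n \<ge> 2"
    and ds: "\<And>H. H \<in> S \<Longrightarrow> verts H = V \<and> double_star H"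
  obtains mate T where
    "\<And>v. v \<in> V \<Longrightarrow> T v \<in> S \<and> T (mate v) = T v \<and> mate v \<in> V \<and> mate (mate v) = v \<and> spine (T v) v (mate v)"
    "\<And>v w. v \<in> V \<Longrightarrow> w \<in> V \<Longrightarrow> v \<noteq> w \<Longrightarrow> {v, w} \<in> edges (T v) \<or> {v, w} \<in> edges (T w)"
    "\<And>v w. v \<in> V \<Longrightarrow> w \<in> V \<Longrightarrow> w \<notin> {v, mate v} \<Longrightarrow> {v, w} \<in> edges (T v) \<Longrightarrow>
       {mate v, mate w} \<in> edges (T v)"
proof -
  have "\<exists>a b. spine H a b" if "H \<in> S" for H
    using double_star_has_spine[of H] ds[OF that] card n by fastforce
  then obtain a b where ab: "\<And>H. H \<in> S \<Longrightarrow> spine H (a H) (b H)" by metis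
  have wf: "wf_graph H" if "H \<in> S" for H
    using part that by (auto simp: graph_partition_def subgraph_def)
  define E where "E = {e. e \<subseteq> V \<and> card e = 2}"
  have E: "(\<Union>H\<in>S. edges H) = E"
    using part by (auto simp: graph_partition_def complete_graph_def E_def)
  have disj: "edges H \<inter> edges H' = {}" if "H \<in> S" "H' \<in> S" "H \<noteq> H'" for H H'
    using part that by (auto simp: graph_partition_def pairwise_def)
  have inE: "{v, w} \<in> E" if "v \<in> V" "w \<in> V" "v \<noteq> w" for v w
    using that by (auto simp: E_def card_2_iff)
  \<comment> \<open>Each tree contains a spine edge, so edge-disjoint trees with equal edge sets
    coincide.\<close>
  have finS: "finite S"
  proof (rule inj_on_finite[of edges])
    show "inj_on edges S"
    proof (rule inj_onI)
      fix H H' assume "H \<in> S" "H' \<in> S" "edges H = edges H'"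
      then show "H = H'" using disj[of H H'] ab[of H] by (auto simp: spine_def)
    qed
    show "edges ` S \<subseteq> Pow E" using E by auto
    show "finite (Pow E)" using fin by (auto simp: E_def)
  qed
  have cardS: "card S = n"
  proof -
    have "card E = (2 * n) choose 2" unfolding E_def using n_subsets[OF fin] card by simp
    also have "\<dots> = n * (2 * n - 1)" by (simp add: choose_two)
    finally have "card (\<Union>H\<in>S. edges H) = n * (2 * n - 1)" using E by simp
    moreover have "card (\<Union>H\<in>S. edges H) = (\<Sum>H\<in>S. card (edges H))"
      using finS disj wf by (intro card_UN_disjoint) (auto simp: finite_edges)
    moreover have "card (edges H) = 2 * n - 1" if "H \<in> S" for H
      using card_edges_spine[OF wf[OF that] ab[OF that]] ds[OF that] card by simp
    ultimately have "card S * (2 * n - 1) = n * (2 * n - 1)" by simp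
    then show ?thesis using n by simp
  qed
  define sp where "sp = (\<lambda>H. {a H, b H})"
  have sp2: "card (sp H) = 2" "sp H \<subseteq> V" if "H \<in> S" for H
    using ab[OF that] ds[OF that] by (auto simp: sp_def spine_def)
  \<comment> \<open>If no spine contains \<open>v\<close>, then \<open>v\<close> is a leaf in every
    tree, so its 2n-1 edges lie in 2n-1 different trees, more than the n available.\<close>
  have cover: "\<exists>H\<in>S. v \<in> sp H" if v: "v \<in> V" for v
  proof (rule ccontr)
    assume no: "\<not> ?thesis"
    define h where "h = (\<lambda>w. SOME H. H \<in> S \<and> {v, w} \<in> edges H)"
    have h: "h w \<in> S \<and> {v, w} \<in> edges (h w)" if "w \<in> V - {v}" for w
    proof -
      have "\<exists>H. H \<in> S \<and> {v, w} \<in> edges H" using inE[of v w] that v E by blast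
      then show ?thesis unfolding h_def by (rule someI_ex)
    qed
    have "inj_on h (V - {v})"
    proof (rule inj_onI)
      fix x y assume xy: "x \<in> V - {v}" "y \<in> V - {v}" "h x = h y"
      define H where "H = h x"
      have H: "H \<in> S" "{v, x} \<in> edges H" "{v, y} \<in> edges H" using h[OF xy(1)] h[OF xy(2)] xy(3) by (auto simp: H_def)
      have "v \<notin> sp H" using no H by auto
      moreover have *: "\<forall>e\<in>edges H. a H \<in> e \<or> b H \<in> e" 
        "\<forall>u\<in>V - {a H, b H}. {a H, u} \<in> edges H \<longleftrightarrow> {b H, u} \<notin> edges H"
        using ab[OF H(1)] ds[OF H(1)] by (auto simp: spine_def)
      ultimately have "x \<in> {a H, b H}" "y \<in> {a H, b H}" "v \<in> V - {a H, b H}"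
        using H v by (auto simp: sp_def)
      then show "x = y" using * H(2,3) by (auto simp: insert_commute)
    qed
    moreover have "h ` (V - {v}) \<subseteq> S" using h by auto
    ultimately have "card (V - {v}) \<le> card S" using finS card_inj_on_le by blast
    then show False using cardS card v n fin by simp
  qed
  \<comment> \<open>The n spines have two vertices each and cover all 2n vertices, so no two of them
    overlap.\<close>
  have sp_inj: "H = H'" if H: "H \<in> S" "H' \<in> S" "v \<in> sp H" "v \<in> sp H'" for H H' v
  proof (rule ccontr)
    assume ne: "H \<noteq> H'"
    have "V \<subseteq> (sp H \<union> sp H') \<union> (\<Union>G\<in>S - {H, H'}. sp G)" using cover by blast
    then have "card V \<le> card ((sp H \<union> sp H') \<union> (\<Union>G\<in>S - {H, H'}. sp G))"
      using finS by (intro card_mono) (auto simp: sp_def)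
    also have "\<dots> \<le> card (sp H \<union> sp H') + card (\<Union>G\<in>S - {H, H'}. sp G)" by (rule card_Un_le)
    also have "card (\<Union>G\<in>S - {H, H'}. sp G) \<le> (\<Sum>G\<in>S - {H, H'}. card (sp G))"
      using finS by (intro card_UN_le) auto
    also have "\<dots> = 2 * (n - 2)"
      using sp2 finS H ne cardS by (simp add: card_Diff_subset)
    finally have *: "card V \<le> card (sp H \<union> sp H') + 2 * (n - 2)" by simp
    have "card (sp H \<union> sp H') + card (sp H \<inter> sp H') = 4"
      using card_Un_Int[of "sp H" "sp H'"] sp2 H by (simp add: sp_def)
    moreover have "card (sp H \<inter> sp H') \<noteq> 0" using H by (auto simp: sp_def)
    ultimately show False using * card n by simp
  qed
  define T where "T = (\<lambda>v. SOME H. H \<in> S \<and> v \<in> sp H)"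
  have T: "T v \<in> S \<and> v \<in> sp (T v)" if "v \<in> V" for v
  proof -
    have "\<exists>H. H \<in> S \<and> v \<in> sp H" using cover that by blast
    then show ?thesis unfolding T_def by (rule someI_ex)
  qed
  have T_eq: "T v = H" if "v \<in> V" "H \<in> S" "v \<in> sp H" for v H
    using sp_inj[of "T v" H v] T that by auto
  define mate where "mate = (\<lambda>v. if v = a (T v) then b (T v) else a (T v))"
  have m: "mate v \<in> V" "sp (T v) = {v, mate v}" "mate v \<noteq> v" if "v \<in> V" for v
  proof -
    have *: "T v \<in> S" "v \<in> sp (T v)" using T that by auto
    show "sp (T v) = {v, mate v}" using * by (auto simp: mate_def sp_def)
    then show "mate v \<in> V" "mate v \<noteq> v" using sp2[OF *(1)] 
      by (auto simp: card_insert_if split: if_splits)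
  qed
  have Tm: "T (mate v) = T v" if "v \<in> V" for v
    using T_eq[of "mate v" "T v"] m[OF that] T[OF that] by auto
  have mm: "mate (mate v) = v" if "v \<in> V" for v
    using m(2)[OF m(1)[OF that]] m(2,3)[OF that] Tm[OF that] by (auto simp: doubleton_eq_iff)
  have spT: "spine (T v) v (mate v)" if "v \<in> V" for v
  proof -
    have "spine (T v) (a (T v)) (b (T v))" using ab T that by blast
    moreover have "v = a (T v) \<and> mate v = b (T v) \<or> v = b (T v) \<and> mate v = a (T v)"
      using T[OF that] by (auto simp: mate_def sp_def)
    ultimately show ?thesis using spine_commute by metis
  qed
  show ?thesis
  proof (rule that[of T mate])
    fix v assume "v \<in> V"
    then show "T v \<in> S \<and> T (mate v) = T v \<and> mate v \<in> V \<and> mate (mate v) = v \<and> spine (T v) v (mate v)"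
      using T Tm m mm spT by blast
  next
    fix v w assume vw: "v \<in> V" "w \<in> V" "v \<noteq> w"
    then obtain H where H: "H \<in> S" "{v, w} \<in> edges H" using inE E by blast
    then have "v \<in> sp H \<or> w \<in> sp H" using ab[OF H(1)] by (auto simp: spine_def sp_def)
    then show "{v, w} \<in> edges (T v) \<or> {v, w} \<in> edges (T w)" using T_eq vw H by blast
  next
    fix v w assume vw: "v \<in> V" "w \<in> V" "w \<notin> {v, mate v}" and e: "{v, w} \<in> edges (T v)"
    have w: "mate w \<in> V" "mate w \<notin> {v, mate v}" "v \<notin> {w, mate w}"
      using vw m mm by (auto, metis+)
    have ne: "T v \<noteq> T w" using m(2)[OF vw(1)] m(2)[OF vw(2)] vw w by auto
    have V: "verts (T v) = V" "verts (T w) = V" using ds T vw by blast+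
    \<comment> \<open>Otherwise \<open>mate w\<close> hangs at \<open>v\<close> in
      \<open>T v\<close>. Then \<open>T v\<close> holds both edges from \<open>v\<close> to the
      spine of \<open>w\<close>, and \<open>T w\<close> cannot reach \<open>v\<close>.\<close>
    show "{mate v, mate w} \<in> edges (T v)"
    proof (rule ccontr)
      assume "\<not> ?thesis"
      then have "{v, mate w} \<in> edges (T v)"
        using spT[OF vw(1)] w V by (auto simp: spine_def)
      then have "{w, v} \<notin> edges (T w)" "{mate w, v} \<notin> edges (T w)"
        using e disj[of "T v" "T w"] ne T vw by (auto simp: insert_commute)
      then show False using spT[OF vw(2)] w V vw by (auto simp: spine_def)
    qed
  qed
qed

section \<open>The matching of the hull points and the window that it forces\<close>

locale spined_points = cyclic_points +
  fixes V :: "complex set" and mate :: "complex \<Rightarrow> complex" and T :: "complex \<Rightarrow> complex graph"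
  assumes V: "V = insert v0 (range q)"
    and verts_T: "v \<in> V \<Longrightarrow> verts (T v) = V"
    and mate: "v \<in> V \<Longrightarrow> mate v \<in> V" "v \<in> V \<Longrightarrow> mate (mate v) = v"
      "v \<in> V \<Longrightarrow> spine (T v) v (mate v)" "v \<in> V \<Longrightarrow> T (mate v) = T v"
    and T_edge: "v \<in> V \<Longrightarrow> w \<in> V \<Longrightarrow> v \<noteq> w \<Longrightarrow> {v, w} \<in> edges (T v) \<or> {v, w} \<in> edges (T w)"
    and T_mates: "v \<in> V \<Longrightarrow> w \<in> V \<Longrightarrow> w \<notin> {v, mate v} \<Longrightarrow> {v, w} \<in> edges (T v) \<Longrightarrow>
       {mate v, mate w} \<in> edges (T v)"
    and T_plane: "v \<in> V \<Longrightarrow> e \<in> edges (T v) \<Longrightarrow> f \<in> edges (T v) \<Longrightarrow> e \<noteq> f \<Longrightarrow> \<not> crossing e f"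
    and mate_center: "mate v0 = q 0"
begin

lemma in_V [simp]: "v0 \<in> V" "q i \<in> V"
  by (auto simp: V)

lemma mate_ne: "v \<in> V \<Longrightarrow> mate v \<noteq> v"
  using mate(3)[of v] by (auto simp: spine_def)

lemma not_crossing_mates:
  assumes vw: "v \<in> V" "w \<in> V" "w \<noteq> v" "w \<noteq> mate v"
  shows "\<not> crossing {v, w} {mate v, mate w}"
proof -
  have ne: "v \<noteq> mate w" "{v, w} \<noteq> {mate v, mate w}"
    using vw mate(2)[OF vw(1)] mate(2)[OF vw(2)] mate_ne[OF vw(1)] by (auto simp: doubleton_eq_iff)
  show ?thesis
  proof (cases "{v, w} \<in> edges (T v)")
    case True
    then show ?thesis using T_mates[of v w] T_plane[of v] vw ne by auto
  next
    case False
    then have *: "{w, v} \<in> edges (T w)" using T_edge[of v w] vw by (auto simp: insert_commute)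
    then have "{mate w, mate v} \<in> edges (T w)" using T_mates[of w v] vw ne by auto
    then show ?thesis using * T_plane[of w] vw ne by (auto simp: insert_commute)
  qed
qed

lemma mate_index:
  assumes i: "i \<in> {1..<L}"
  obtains j where "j \<in> {1..<L}" "mate (q i) = q j" "j \<noteq> i"
proof -
  have L0: "L > 0" using L n2 by simp
  have "mate (q i) \<noteq> v0"
  proof
    assume "mate (q i) = v0"
    then have "q 0 = q i" using mate(2)[of "q i"] mate_center by simp
    then show False using q_inj[of 0 i] i L0 by auto
  qed
  moreover have "mate (q i) \<in> V" by (simp add: mate)
  ultimately obtain l where "mate (q i) = q l" by (auto simp: V)
  then have l: "mate (q i) = q (l mod L)" "l mod L < L" using q_mod L0 by auto
  have "l mod L \<noteq> 0"
  proof
    assume "l mod L = 0"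
    then have "mate (mate v0) = q i" using l mate_center mate(2)[of "q i"] by simp
    then show False using mate(2)[of v0] q_ne_center by simp
  qed
  moreover have "l mod L \<noteq> i" using l mate_ne[of "q i"] by auto
  ultimately show ?thesis using that[of "l mod L"] l by auto
qed

text \<open>If the spines are two opposite sides of a convex quadrilateral, its diagonals join an
  end of one spine to an end of the other and the remaining ends to each other. They cross, against
  \<open>not_crossing_mates\<close>.\<close>

lemma no_uncrossed_spines:
  assumes "a < b" "b < c" "c < d" "d < L"
  shows "\<not> (mate (q a) = q b \<and> mate (q c) = q d)" "\<not> (mate (q a) = q d \<and> mate (q b) = q c)"
proof -
  have cr: "crossing {q a, q c} {q b, q d}" using assms by (intro crossing_hull) auto
  have ne: "q c \<noteq> q a" "q c \<noteq> q b" "q c \<noteq> q d" using assms q_inj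
    by (metis less_trans less_irrefl)+
  show "\<not> (mate (q a) = q b \<and> mate (q c) = q d)"
    using not_crossing_mates[of "q a" "q c"] cr ne by auto
  show "\<not> (mate (q a) = q d \<and> mate (q b) = q c)"
  proof
    assume *: "mate (q a) = q d \<and> mate (q b) = q c"
    then have "mate (q c) = q b" using mate(2)[of "q b"] by simp
    then show False using not_crossing_mates[of "q a" "q c"] cr ne * by (auto simp: insert_commute)
  qed
qed

text \<open>Spines cross pairwise, so the points strictly inside the chord of a spine are matched
  with those outside. The 2n-4 points other than its ends and \<open>q 0\<close> are thus split
  evenly, and n-2 points lie inside the chord.\<close>

lemma mate_opposite:
  assumes i: "1 \<le> i" "i < n"
  shows "mate (q i) = q (i + n - 1)"
proof -
  have "\<exists>j. i \<in> {1..<L} \<longrightarrow> j \<in> {1..<L} \<and> mate (q i) = q j \<and> j \<noteq> i" for i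
  proof (cases "i \<in> {1..<L}")
    case True
    then show ?thesis using mate_index[OF True] by blast
  qed auto
  then obtain \<mu> where "\<And>i. i \<in> {1..<L} \<longrightarrow> \<mu> i \<in> {1..<L} \<and> mate (q i) = q (\<mu> i) \<and> \<mu> i \<noteq> i"
    by metis
  then have \<mu>: "\<mu> i \<in> {1..<L}" "mate (q i) = q (\<mu> i)" "\<mu> i \<noteq> i" if "i \<in> {1..<L}" for i
    using that by auto
  have \<mu>\<mu>: "\<mu> (\<mu> i) = i" if i: "i \<in> {1..<L}" for i
  proof -
    have "q (\<mu> (\<mu> i)) = q i" using \<mu>[OF i] \<mu>(2)[OF \<mu>(1)[OF i]] mate(2)[of "q i"] by simp
    then show ?thesis using q_inj \<mu>(1)[OF \<mu>(1)[OF i]] i by auto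
  qed
  have K1: False if "a < \<mu> a" "\<mu> a < c" "c < \<mu> c" "a \<in> {1..<L}" "c \<in> {1..<L}" for a c
    using no_uncrossed_spines(1)[of a "\<mu> a" c "\<mu> c"] that \<mu> by auto
  have K2: False if "a < b" "b < \<mu> b" "\<mu> b < \<mu> a" "a \<in> {1..<L}" "b \<in> {1..<L}" for a b
    using no_uncrossed_spines(2)[of a b "\<mu> b" "\<mu> a"] that \<mu> by auto
  have main: "\<mu> i = i + n - 1" if i: "i \<in> {1..<L}" "i < \<mu> i" for i
  proof -
    define I where "I = {i<..<\<mu> i}"
    define J where "J = {1..<L} - {i..\<mu> i}"
    have mi: "\<mu> i \<in> {1..<L}" "\<mu> (\<mu> i) = i" using \<mu> \<mu>\<mu> i by auto
    have sub: "I \<subseteq> {1..<L}" "J \<subseteq> {1..<L}" using mi i by (auto simp: I_def J_def)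
    have ni: "\<mu> j \<noteq> i" "\<mu> j \<noteq> \<mu> i" if "j \<in> {1..<L}" "j \<noteq> i" "j \<noteq> \<mu> i" for j
      using that \<mu>\<mu> mi by metis+
    have IJ: "\<mu> j \<in> J" if j: "j \<in> I" for j
    proof (rule ccontr)
      assume "\<mu> j \<notin> J"
      then have "\<mu> j \<in> I" using ni[of j] \<mu>(1)[of j] j sub by (auto simp: I_def J_def)
      moreover have jL: "j \<in> {1..<L}" using j sub by auto
      moreover have "i < j" using j by (simp add: I_def)
      ultimately show False
        using K2[of i j] K2[of i "\<mu> j"] \<mu>\<mu>[OF jL] \<mu>(1,3)[OF jL] i j
        by (cases "j < \<mu> j") (auto simp: I_def)
    qed
    have JI: "\<mu> j \<in> I" if j: "j \<in> J" for j
    proof (rule ccontr)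
      assume no: "\<mu> j \<notin> I"
      have jL: "j \<in> {1..<L}" using j sub by auto
      have out: "j < i \<or> j > \<mu> i" "\<mu> j < i \<or> \<mu> j > \<mu> i"
      proof -
        have ij: "j < i \<or> j > \<mu> i" using j by (auto simp: J_def)
        then have "j \<noteq> i" "j \<noteq> \<mu> i" using i(2) by linarith+
        then have "\<mu> j \<noteq> i" "\<mu> j \<noteq> \<mu> i" using ni[OF jL] by blast+
        then show "j < i \<or> j > \<mu> i" "\<mu> j < i \<or> \<mu> j > \<mu> i"
          using ij no by (auto simp: I_def)
      qed
      \<comment> \<open>A spine with both ends outside the chord from \<open>i\<close> to
        \<open>\<mu> i\<close> lies before it, after it or around it; \<open>K1\<close> excludes the
        first two positions and \<open>K2\<close> the third.\<close>
      have *: False if j: "j < \<mu> j" "j < i \<or> j > \<mu> i" "\<mu> j < i \<or> \<mu> j > \<mu> i" "j \<in> {1..<L}" for j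
      proof -
        consider "\<mu> j < i" | "j > \<mu> i" | "j < i" "\<mu> j > \<mu> i" using j by linarith
        then show False
          by cases (use K1[OF j(1) _ i(2) j(4) i(1)] K1[OF i(2) _ j(1) i(1) j(4)]
            K2[OF _ i(2) _ j(4) i(1)] in blast)+
      qed
      have m: "\<mu> j \<in> {1..<L}" "\<mu> (\<mu> j) = j" "\<mu> j \<noteq> j" using \<mu>[OF jL] \<mu>\<mu>[OF jL] by auto
      show False
      proof (cases "j < \<mu> j")
        case True
        then show False using * out jL by blast
      next
        case False
        then have "\<mu> j < \<mu> (\<mu> j)" using m by simp
        then show False using *[of "\<mu> j"] out m by simp
      qed
    qed
    have "bij_betw \<mu> I J"
      by (rule bij_betw_byWitness[where f' = \<mu>]) (use IJ JI sub \<mu>\<mu> in auto)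
    then have "card I = card J" by (rule bij_betw_same_card)
    moreover have "card J = (L - 1) - (\<mu> i - i + 1)"
      unfolding J_def using i mi by (subst card_Diff_subset) auto
    moreover have "card I = \<mu> i - i - 1" by (simp add: I_def)
    moreover have "\<mu> i - i + 1 \<le> L - 1" using i mi by auto
    ultimately show ?thesis using i L by linarith
  qed
  have iL: "i \<in> {1..<L}" using i L by auto
  show ?thesis
  proof (cases "i < \<mu> i")
    case True
    then show ?thesis using main[OF iL] \<mu>[OF iL] by simp
  next
    case False
    then have "\<mu> i < i" using \<mu>[OF iL] by auto
    then have "i = \<mu> i + n - 1" using main[of "\<mu> i"] \<mu>[OF iL] \<mu>\<mu>[OF iL] by auto
    then show ?thesis using \<mu>(1)[OF iL] i by auto
  qed
qed

lemma center_edge: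
  assumes v: "v \<in> V" "v \<noteq> v0" "mate v \<noteq> v0" and e: "{v, v0} \<in> edges (T v)"
  shows "{mate v, q 0} \<in> edges (T v)"
  using T_mates[of v v0] v e mate_center by auto

text \<open>The chord from \<open>q j\<close> to \<open>q (j + n)\<close> separates
  \<open>v0\<close> from the points between them. For \<open>j = 0\<close> and
  \<open>j = n - 1\<close> it joins \<open>q 0\<close> to a spine end whose mate lies behind it,
  against \<open>not_crossing_mates\<close>. Otherwise it joins the spines of \<open>q j\<close> and
  \<open>q (j + 1)\<close> and lies in the tree of one of its endpoints. There \<open>v0\<close>
  cannot hang at the end of the spine behind the chord, so it hangs at the other end. By
  \<open>center_edge\<close> the end behind the chord is then adjacent to \<open>q 0\<close>, and
  this edge crosses the chord.\<close>

lemma not_narrow_initial: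
  assumes j: "j < n"
  shows "\<not> narrow j"
proof
  assume nar: "narrow j"
  have cen: "crossing {v0, q b} {q j, q (j + n)}" if "j < b" "b < j + n" for b
    using that nar by (intro crossing_center) (auto simp: narrow_def)
  have qL: "q L = q 0" using q_per[of 0] by simp
  consider "j = 0" | "j = n - 1" | "1 \<le> j" "j + 2 \<le> n" using j by linarith
  then show False
  proof cases
    case 1
    have "mate (q 1) = q n" using mate_opposite[of 1] n2 by simp
    moreover have "\<not> crossing {v0, q 1} {mate v0, mate (q 1)}"
      using q_inj[of 1 0] n2 L mate_center q_ne_center by (intro not_crossing_mates) auto
    ultimately show False using cen[of 1] 1 mate_center n2 by simp
  next
    case 2
    have m: "mate (q (n - 1)) = q (2 * n - 2)" using mate_opposite[of "n - 1"] n2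
      by (simp add: numeral_2_eq_2)
    then have m': "mate (q (2 * n - 2)) = q (n - 1)" using mate(2)[of "q (n - 1)"] by simp
    have "\<not> crossing {v0, q (2 * n - 2)} {mate v0, mate (q (2 * n - 2))}"
    proof (intro not_crossing_mates)
      have "2 * n - 2 < L" "0 < L" using n2 L by linarith+
      then show "q (2 * n - 2) \<noteq> mate v0"
        using q_inj[of "2 * n - 2" 0] n2 unfolding mate_center by auto
    qed (auto simp: q_ne_center)
    moreover have "j + n = L" using 2 L n2 by simp
    moreover have "j < 2 * n - 2" "2 * n - 2 < L" using 2 L n2 by linarith+
    ultimately show False
      using cen[of "2 * n - 2"] 2(1) mate_center m' qL by (auto simp: insert_commute)
  next
    case 3
    have m1: "mate (q j) = q (j + n - 1)" using mate_opposite 3 by simp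
    have m2: "mate (q (j + 1)) = q (j + n)" using mate_opposite[of "j + 1"] 3 by simp
    have m1': "mate (q (j + n - 1)) = q j" using mate(2)[of "q j"] m1 by simp
    have m2': "mate (q (j + n)) = q (j + 1)" using mate(2)[of "q (j + 1)"] m2 by simp
    have ne: "q j \<noteq> q (j + n)" "q 0 \<noteq> q j" "q 0 \<noteq> q (j + n)" "q 0 \<noteq> q (j + 1)"
      "q 0 \<noteq> q (j + n - 1)"
      by (rule q_ne(1); use 3 L in linarith)+
    have eV: "v0 \<noteq> q i" "q i \<noteq> v0" for i using q_ne_center by auto
    show False
    proof (cases "{q j, q (j + n)} \<in> edges (T (q j))")
      case True
      have "crossing {v0, q (j + n - 1)} {q j, q (j + n)}"
        by (rule cen; use 3 in linarith)
      then have "{v0, q (j + n - 1)} \<notin> edges (T (q j))"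
        using T_plane[of "q j" _ "{q j, q (j + n)}"] True eV
        by (auto simp: doubleton_eq_iff)
      then have "{q j, v0} \<in> edges (T (q j))"
        using mate(3)[of "q j"] verts_T[of "q j"] m1 eV by (auto simp: spine_def insert_commute)
      then have "{q (j + n - 1), q 0} \<in> edges (T (q j))"
        using center_edge[of "q j"] m1 eV by auto
      moreover have "crossing {q 0, q (j + n - 1)} {q j, q (j + n)}"
        using 3 L by (intro crossing_hull) auto
      ultimately show False
        using T_plane[of "q j" "{q 0, q (j + n - 1)}" "{q j, q (j + n)}"] True ne
        by (auto simp: insert_commute doubleton_eq_iff)
    next
      case False
      then have e: "{q j, q (j + n)} \<in> edges (T (q (j + n)))" using T_edge[of "q j" "q (j + n)"] ne
        by auto
      have "{v0, q (j + 1)} \<notin> edges (T (q (j + n)))"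
        using T_plane[of "q (j + n)" _ "{q j, q (j + n)}"] e cen[of "j + 1"] 3 eV
        by (auto simp: doubleton_eq_iff)
      then have "{q (j + n), v0} \<in> edges (T (q (j + n)))"
        using mate(3)[of "q (j + n)"] verts_T[of "q (j + n)"] m2' eV
        by (auto simp: spine_def insert_commute)
      then have "{q (j + 1), q 0} \<in> edges (T (q (j + n)))"
        using center_edge[of "q (j + n)"] m2' eV by auto
      moreover have "crossing {q 0, q (j + 1)} {q j, q (j + n)}"
        using 3 L by (intro crossing_hull) auto
      ultimately show False
        using T_plane[of "q (j + n)" "{q 0, q (j + 1)}" "{q j, q (j + n)}"] e ne
        by (auto simp: insert_commute doubleton_eq_iff)
    qed
  qed
qed

end

context cyclic_points
begin

lemma range_shift: "range (\<lambda>i. q (i + x)) = range q"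
proof
  show "range q \<subseteq> range (\<lambda>i. q (i + x))"
  proof
    fix p assume "p \<in> range q"
    then obtain j where "p = q j" by auto
    \<comment> \<open>Adding \<open>x\<close> full turns makes the index large enough for the
      subtraction of \<open>x\<close>.\<close>
    moreover have "j + L * x = (j + L * x - x) + x" using L n2 by (cases L) auto
    ultimately show "p \<in> range (\<lambda>i. q (i + x))" using q_add_mult[of j x] by (metis rangeI)
  qed
qed auto

lemma inj_on_q: "inj_on q {..<L}"
  by (rule inj_onI) (auto intro: q_inj)

lemma range_q: "range q = q ` {..<L}"
proof -
  have "q i \<in> q ` {..<L}" for i
    using q_mod[of i] L n2 by (intro image_eqI[of _ _ "i mod L"]) auto
  then show ?thesis by auto
qed

lemma card_points: "finite (insert v0 (range q))" "card (insert v0 (range q)) = 2 * n"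
proof -
  have "v0 \<notin> q ` {..<L}" using q_ne_center by auto
  then show "finite (insert v0 (range q))" "card (insert v0 (range q)) = 2 * n"
    unfolding range_q using L by (simp_all add: card_image[OF inj_on_q])
qed

lemma partitionable_imp_window:
  assumes "partitionable_into_plane_spanning_double_stars (complete_graph (insert v0 (range q)))"
  shows "\<exists>x. \<forall>j<n. \<not> narrow (x + j)"
proof -
  define V where "V = insert v0 (range q)"
  obtain S where S: "graph_partition (complete_graph V) S"
    "\<And>H. H \<in> S \<Longrightarrow> plane_graph H \<and> verts H = V \<and> double_star H"
    using assms by (auto simp: partitionable_into_plane_spanning_double_stars_def V_def complete_graph_def)
  obtain mate T where
    M: "\<And>v. v \<in> V \<Longrightarrow> T v \<in> S \<and> T (mate v) = T v \<and> mate v \<in> V \<and> mate (mate v) = v \<and> spine (T v) v (mate v)"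
    "\<And>v w. v \<in> V \<Longrightarrow> w \<in> V \<Longrightarrow> v \<noteq> w \<Longrightarrow> {v, w} \<in> edges (T v) \<or> {v, w} \<in> edges (T w)"
    "\<And>v w. v \<in> V \<Longrightarrow> w \<in> V \<Longrightarrow> w \<notin> {v, mate v} \<Longrightarrow> {v, w} \<in> edges (T v) \<Longrightarrow>
       {mate v, mate w} \<in> edges (T v)"
    by (rule partition_spines[OF S(1) card_points(1)[folded V_def] card_points(2)[folded V_def] n2])
      (use S(2) in blast)+
  have "v0 \<in> V" by (simp add: V_def)
  then have "mate v0 \<in> V" "mate v0 \<noteq> v0" using M(1)[of v0] by (auto simp: spine_def)
  \<comment> \<open>The window starts at the hull point matched to the center.\<close>
  then obtain x where x: "mate v0 = q x" by (auto simp: V_def)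
  interpret sh: cyclic_points v0 "\<lambda>i. q (i + x)" "\<lambda>i. phi (i + x)" "\<lambda>i. rho (i + x)" n L
    by (rule cyclic_points_shift)
  interpret sp: spined_points v0 "\<lambda>i. q (i + x)" "\<lambda>i. phi (i + x)" "\<lambda>i. rho (i + x)" n L V mate T
  proof unfold_locales
    show "V = insert v0 (range (\<lambda>i. q (i + x)))" by (simp add: V_def range_shift)
    show "\<not> crossing e f" if "v \<in> V" "e \<in> edges (T v)" "f \<in> edges (T v)" "e \<noteq> f" for v e f
      using S(2)[of "T v"] M(1) that by (auto simp: plane_graph_def crossing_def)
    show "mate v0 = q (0 + x)" using x by simp
    show "verts (T v) = V" if "v \<in> V" for v using S(2) M(1) that by blast
  qed (use M in blast)+
  have "\<not> narrow (x + j)" if "j < n" for j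
    using sp.not_narrow_initial[OF that] by (simp add: narrow_def sh.narrow_def ac_simps)
  then show ?thesis by blast
qed

end

section \<open>The partition built from a window\<close>

lemma spine_imp_double_star:
  assumes wf: "wf_graph H" and sp: "spine H a b"
  shows "double_star H"
proof (rule double_starI)
  define f where "f = (\<lambda>v. if {a, v} \<in> edges H then a else b)"
  show "finite (verts H)" using wf by (simp add: wf_graph_def)
  show ab: "a \<in> verts H" "b \<in> verts H" "a \<noteq> b" using sp by (auto simp: spine_def)
  show "f v \<in> {a, b}" for v by (simp add: f_def)
  show "edges H = insert {a, b} ((\<lambda>v. {f v, v}) ` (verts H - {a, b}))"
  proof (intro equalityI subsetI)
    fix e assume e: "e \<in> edges H"
    show "e \<in> insert {a, b} ((\<lambda>v. {f v, v}) ` (verts H - {a, b}))"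
    proof (cases "e = {a, b}")
      case False
      obtain u where u: "u = a \<or> u = b" "u \<in> e" using sp e by (auto simp: spine_def)
      obtain w where w: "e = {u, w}" "w \<noteq> u" "w \<in> verts H" using wf_edge_cases[OF wf e u(2)] by metis
      have wab: "w \<in> verts H - {a, b}" using w u False by (auto simp: insert_commute)
      moreover have "{f w, w} = e"
      proof (cases "u = a")
        case False
        then have "{a, w} \<notin> edges H" using sp wab w u e by (auto simp: spine_def)
        then show ?thesis using w u False by (simp add: f_def)
      qed (use w e in \<open>simp add: f_def\<close>)
      ultimately show ?thesis by blast
    qed simp
  next
    have ab: "{a, b} \<in> edges H" using sp by (simp add: spine_def)
    have f: "{f v, v} \<in> edges H" if "v \<in> verts H - {a, b}" for v
      using sp that unfolding spine_def f_def by presburger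
    fix e assume "e \<in> insert {a, b} ((\<lambda>v. {f v, v}) ` (verts H - {a, b}))"
    then show "e \<in> edges H" using ab f by blast
  qed
qed simp

context cyclic_points
begin

text \<open>
  The construction: a hull edge \<open>{q a, q b}\<close> is owned by the endpoint from which the other one is
  reached by fewer than \<open>n\<close> counterclockwise steps.  The trees have the spines \<open>q 0, v0\<close> and
  \<open>q i, q (i + n - 1)\<close> for \<open>0 < i < n\<close>, and a hull edge belongs to the tree of its owner.
\<close>

definition owner :: "nat \<Rightarrow> nat \<Rightarrow> nat" where
  "owner a b = (if b < a + n then a else b)"

text \<open>An index \<open>x\<close> of at least \<open>n\<close> is the far end
  \<open>i + n - 1\<close> of spine \<open>i\<close>, so \<open>i = x + 1 - n\<close>.\<close>

definition tree_of :: "nat \<Rightarrow> nat" where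
  "tree_of x = (if x < n then x else x + 1 - n)"

text \<open>For \<open>0 < j < n\<close> the center is a leaf of tree \<open>j\<close> and hangs at
  the near end \<open>q j\<close>. All other edges at the center belong to tree 0, where
  \<open>v0\<close> is itself a spine end.\<close>

definition center_tree_of :: "nat \<Rightarrow> nat" where
  "center_tree_of j = (if j < n then j else 0)"

definition double_star_edges :: "nat \<Rightarrow> complex set set" where
  "double_star_edges i = {{q a, q b} | a b. a < b \<and> b < L \<and> tree_of (owner a b) = i} \<union>
     {{v0, q j} | j. j < L \<and> center_tree_of j = i}"

lemma hull_edge_iff:
  assumes "a < b" "b < L"
  shows "{q a, q b} \<in> double_star_edges i \<longleftrightarrow> tree_of (owner a b) = i"
proof
  assume "{q a, q b} \<in> double_star_edges i"
  then obtain c d where cd: "{q a, q b} = {q c, q d}" "c < d" "d < L" "tree_of (owner c d) = i"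
    using q_ne_center by (fastforce simp: double_star_edges_def doubleton_eq_iff)
  then have "q a = q c \<and> q b = q d \<or> q a = q d \<and> q b = q c" by (simp add: doubleton_eq_iff)
  then have "a = c \<and> b = d \<or> a = d \<and> b = c"
    using q_inj[of a c] q_inj[of b d] q_inj[of a d] q_inj[of b c] assms cd by auto
  then show "tree_of (owner a b) = i" using cd assms by auto
qed (use assms in \<open>auto simp: double_star_edges_def\<close>)

lemma center_edge_iff:
  assumes "j < L"
  shows "{v0, q j} \<in> double_star_edges i \<longleftrightarrow> center_tree_of j = i"
proof
  assume "{v0, q j} \<in> double_star_edges i"
  then obtain l where "{v0, q j} = {v0, q l}" "l < L" "center_tree_of l = i"
    using q_ne_center by (fastforce simp: double_star_edges_def doubleton_eq_iff)
  then show "center_tree_of j = i"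
    using q_inj[of j l] assms by (auto simp: doubleton_eq_iff)
qed (use assms in \<open>auto simp: double_star_edges_def\<close>)

definition double_star_graph :: "nat \<Rightarrow> complex graph" where
  "double_star_graph i = \<lparr>verts = insert v0 (range q), edges = double_star_edges i\<rparr>"

lemma wf_double_star_graph: "wf_graph (double_star_graph i)"
proof -
  have "card {q a, q b} = 2" if "a < b" "b < L" for a b
    using q_ne[of a b] that by simp
  moreover have "card {v0, q j} = 2" for j using q_ne_center[of j] by simp
  ultimately show ?thesis
    using card_points(1) by (auto simp: wf_graph_def double_star_graph_def double_star_edges_def)
qed

lemma point_cases:
  assumes "v \<in> insert v0 (range q)"
  obtains "v = v0" | j where "j < L" "v = q j"
  using assms by (auto simp: range_q)

text \<open>In tree 0, \<open>q 0\<close> takes the hull points \<open>1\<close> to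
  \<open>n - 1\<close> and \<open>v0\<close> takes the points from \<open>n\<close> on.\<close>

lemma spine_0: "spine (double_star_graph 0) (q 0) v0"
proof -
  have L0: "0 < L" "n < L" using L n2 by linarith+
  have touch: "q 0 \<in> e \<or> v0 \<in> e" if "e \<in> double_star_edges 0" for e
  proof -
    have "a = 0" if "a < b" "b < L" "tree_of (owner a b) = 0" for a b
      using that n2 by (auto simp: tree_of_def owner_def split: if_splits)
    then show ?thesis using that by (fastforce simp: double_star_edges_def)
  qed
  have xor: "{q 0, v} \<in> double_star_edges 0 \<longleftrightarrow> {v0, v} \<notin> double_star_edges 0"
    if v: "v \<in> insert v0 (range q) - {q 0, v0}" for v
  proof -
    obtain j where j: "j < L" "v = q j" using v point_cases by blast
    then have "j > 0" using v by (cases j) auto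
    then show ?thesis using j hull_edge_iff[of 0 j 0] center_edge_iff[of j 0] n2
      by (auto simp: tree_of_def owner_def center_tree_of_def)
  qed
  have "{q 0, v0} \<in> double_star_edges 0"
    using center_edge_iff[of 0 0] L0 n2 by (simp add: center_tree_of_def insert_commute)
  then show ?thesis
    using touch xor q_ne_center[of 0] by (auto simp: spine_def double_star_graph_def)
qed

text \<open>The near end takes the indices \<open>i + 1\<close> to \<open>i + n - 1\<close>, the far
  end takes \<open>i + n\<close> to \<open>i + L - 1\<close>; up to period \<open>L\<close> these
  are all hull indices except \<open>i\<close>, each once.\<close>

lemma spine_pos:
  assumes i: "0 < i" "i < n"
  shows "spine (double_star_graph i) (q i) (q (i + n - 1))"
proof -
  define k where "k = i + n - 1"
  have k: "i < k" "k < L" "k \<ge> n" "k = i + n - 1" using i n2 L by (auto simp: k_def)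
  have tr: "x = i \<or> x = k" if "tree_of x = i" for x
    using that i by (auto simp: tree_of_def k_def split: if_splits)
  have touch: "q i \<in> e \<or> q k \<in> e" if e: "e \<in> double_star_edges i" for e
  proof -
    have "a = i \<or> b = i \<or> a = k \<or> b = k" if "tree_of (owner a b) = i" for a b
      using tr[OF that] by (auto simp: owner_def split: if_splits)
    moreover have "j = i" if "center_tree_of j = i" for j
      using that i by (auto simp: center_tree_of_def split: if_splits)
    ultimately show ?thesis using e by (fastforce simp: double_star_edges_def)
  qed
  have xor: "{q i, v} \<in> double_star_edges i \<longleftrightarrow> {q k, v} \<notin> double_star_edges i"
    if v: "v \<in> insert v0 (range q) - {q i, q k}" for v
  proof -
    have "v \<in> insert v0 (range q)" using v by simp
    then show ?thesis
    proof (cases rule: point_cases)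
      case 1
      then show ?thesis
        using center_edge_iff[of i i] center_edge_iff[of k i] k i
        by (auto simp: center_tree_of_def insert_commute)
    next
      case (2 j)
      then have ne: "j \<noteq> i" "j \<noteq> k" using v by auto
      have h: "{q x, q j} \<in> double_star_edges i \<longleftrightarrow> tree_of (owner (min x j) (max x j)) = i"
        if "x < L" "x \<noteq> j" for x
        using hull_edge_iff[of x j i] hull_edge_iff[of j x i] that 2
        by (auto simp: insert_commute min_def max_def)
      show ?thesis
        unfolding 2(2) using h[of i] h[of k] k i ne L 2(1)
        by (auto simp: min_def max_def tree_of_def owner_def split: if_splits)
    qed
  qed
  have "{q i, q k} \<in> double_star_edges i"
    using hull_edge_iff[of i k i] k i by (simp add: owner_def tree_of_def)
  moreover have "q i \<noteq> q k" using q_ne k by simp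
  ultimately have "spine (double_star_graph i) (q i) (q k)"
    using touch xor by (auto simp: spine_def double_star_graph_def)
  then show ?thesis by (simp add: k_def)
qed

lemma double_star_edges_cases:
  assumes "e \<in> double_star_edges i"
  obtains x s where "x < L" "tree_of x = i" "1 \<le> s" "s < n" "e = {q x, q (x + s)}"
  | j where "j < L" "center_tree_of j = i" "e = {v0, q j}"
proof -
  from assms consider a b where "a < b" "b < L" "tree_of (owner a b) = i" "e = {q a, q b}"
    | j where "j < L" "center_tree_of j = i" "e = {v0, q j}"
    unfolding double_star_edges_def by blast
  then show ?thesis
  proof cases
    case (1 a b)
    show ?thesis
    proof (cases "b < a + n")
      case True
      then show ?thesis using 1 by (intro that(1)[of a "b - a"]) (auto simp: owner_def)
    next
      case False
      \<comment> \<open>The owner is \<open>b\<close>, and \<open>q a\<close> is reached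
        counterclockwise as index \<open>a + L\<close>, after at most \<open>L - n = n - 1\<close>
        steps.\<close>
      have "q (b + (a + L - b)) = q a" using 1 q_per[of a] by simp
      then show ?thesis using 1 False L
        by (intro that(1)[of b "a + L - b"]) (auto simp: owner_def insert_commute)
    qed
  qed (use that in blast)
qed

section \<open>Planarity of the constructed trees\<close>

lemma not_narrow_gt:
  assumes "\<not> narrow j" "a \<le> j" "j + n \<le> b"
  shows "phi b - phi a > pi"
proof -
  have "phi a \<le> phi j" "phi (j + n) \<le> phi b"
    using assms phi_mono[of a j] phi_mono[of "j + n" b] by (auto simp: le_less)
  moreover have "phi (j + n) - phi j > pi" using assms(1) phi_ne_pi[of "j + n" j] by (simp add: narrow_def)
  ultimately show ?thesis by simp
qed

text \<open>Chords of one owner share an endpoint. Those owned by the two ends \<open>x\<close> and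
  \<open>x + n - 1\<close> stay in the index ranges \<open>x\<close> to \<open>x + n - 1\<close> and
  \<open>x + n - 1\<close> to \<open>x + L - 1\<close>, which meet in one index only.\<close>

lemma not_crossing_tree_hull:
  assumes i: "i < n" and x: "tree_of x = i" "1 \<le> s" "s < n" and y: "tree_of y = i" "1 \<le> t" "t < n"
    and ne: "{q x, q (x + s)} \<noteq> {q y, q (y + t)}"
  shows "\<not> crossing {q x, q (x + s)} {q y, q (y + t)}"
proof -
  have same: "\<not> crossing {q x, q (x + s)} {q x, q (x + t)}" if "1 \<le> s" "s < t" "t < n" for x s t
    using not_crossing_hull[of x "x + s" "x + t" "x + L"] q_per[of x] that L
    by (simp add: insert_commute)
  have diff: "\<not> crossing {q x, q (x + s)} {q y, q (y + t)}"
    if "y = x + n - 1" "1 \<le> s" "1 \<le> t" "s < n" "t < n" for x y s t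
    using that L by (intro not_crossing_hull) auto
  have "x = y \<or> y = x + n - 1 \<or> x = y + n - 1"
    using x(1) y(1) unfolding tree_of_def by (simp split: if_splits; linarith)
  moreover have "s \<noteq> t" if "x = y" using ne that by auto
  ultimately consider "x = y" "s < t" | "x = y" "t < s" | "y = x + n - 1" | "x = y + n - 1"
    by linarith
  then show ?thesis
  proof cases
    case 1
    then show ?thesis using same x y by simp
  next
    case 2
    then show ?thesis using same[of t s x] x y by (simp add: crossing_commute)
  next
    case 3
    then show ?thesis using diff x y by simp
  next
    case 4
    then show ?thesis using diff[of x y t s] x y by (simp add: crossing_commute)
  qed
qed

text \<open>Apart from edges that share an endpoint, the arc of the chord that contains
  \<open>q j\<close> must exceed pi. In tree 0 it contains the run of n+1 indices that starts at
  \<open>n - 1\<close>, in tree \<open>i > 0\<close> the run that starts at \<open>i - 1\<close>;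
  neither start is narrow.\<close>

lemma not_crossing_tree_center:
  assumes nar: "\<And>j. j < n \<Longrightarrow> \<not> narrow j"
    and i: "i < n" and x: "x < L" "tree_of x = i" "1 \<le> s" "s < n" and j: "j < L" "center_tree_of j = i"
  shows "\<not> crossing {v0, q j} {q x, q (x + s)}"
proof (cases "j = x")
  case True
  then show ?thesis using not_crossing_adjacent(1)[of x "x + s"] x L by simp
next
  case False
  show ?thesis
  proof (cases "i = 0")
    case True
    then have x0: "x = 0" and jn: "j \<ge> n" 
      using x j False by (auto simp: tree_of_def center_tree_of_def split: if_splits)
    have "phi L - phi s > pi" using x L n2 by (intro not_narrow_gt[OF nar[of "n - 1"]]) auto
    then have "\<not> crossing {v0, q j} {q s, q L}"
      using x j jn by (intro not_crossing_center) auto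
    then show ?thesis using q_per[of 0] x0 by (simp add: insert_commute)
  next
    case i0: False
    then have ji: "j = i" and xi: "x = i + n - 1"
      using x j False by (auto simp: tree_of_def center_tree_of_def split: if_splits)
    have "\<not> narrow (i - 1 + L)"
    proof -
      have "phi (i - 1 + L + n) = phi (i - 1 + n) + 2 * pi" 
        using phi_per[of "i - 1 + n"] by (simp add: ac_simps)
      then show ?thesis using nar[of "i - 1"] phi_per[of "i - 1"] i by (simp add: narrow_def)
    qed
    then have "phi (x + L) - phi (x + s) > pi"
      using x xi i0 L by (intro not_narrow_gt[of "i - 1 + L"]) auto
    then have "\<not> crossing {v0, q (i + L)} {q (x + s), q (x + L)}"
      using x xi i0 L by (intro not_crossing_center) auto
    then show ?thesis using q_per ji by (simp add: insert_commute)
  qed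
qed

lemma plane_double_star_graph:
  assumes nar: "\<And>j. j < n \<Longrightarrow> \<not> narrow j" and i: "i < n"
  shows "plane_graph (double_star_graph i)"
proof -
  have "\<not> crossing e f" if e: "e \<in> double_star_edges i" and f: "f \<in> double_star_edges i" 
    and ne: "e \<noteq> f" for e f
    using e
  proof (cases rule: double_star_edges_cases)
    case e1: (1 x s)
    from f show ?thesis
    proof (cases rule: double_star_edges_cases)
      case f1: (1 y t)
      then show ?thesis using e1 not_crossing_tree_hull[OF i] ne by simp
    next
      case f2: (2 j)
      then show ?thesis using not_crossing_tree_center[OF nar i] e1 by (simp add: crossing_commute)
    qed
  next
    case e2: (2 j)
    from f show ?thesis
    proof (cases rule: double_star_edges_cases)
      case f1: (1 y t)
      then show ?thesis using not_crossing_tree_center[OF nar i] e2 by simp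
    next
      case f2: (2 l)
      then have "j \<noteq> l" using e2 ne by auto
      then show ?thesis
        using not_crossing_center_edges[of j l] not_crossing_center_edges[of l j] e2 f2
        by (cases "j < l") (auto simp: crossing_commute)
    qed
  qed
  then show ?thesis by (auto simp: plane_graph_def double_star_graph_def crossing_def)
qed

lemma window_imp_partitionable_aux:
  assumes nar: "\<And>j. j < n \<Longrightarrow> \<not> narrow j"
  shows "partitionable_into_plane_spanning_double_stars (complete_graph (insert v0 (range q)))"
  unfolding partitionable_into_plane_spanning_double_stars_def
proof (intro exI conjI ballI)
  define S where "S = double_star_graph ` {..<n}"
  have ds: "double_star (double_star_graph i)" if "i < n" for i
    using spine_imp_double_star[OF wf_double_star_graph] spine_0 spine_pos that by (cases "i = 0") auto
  fix H assume "H \<in> S"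
  then obtain i where i: "i < n" "H = double_star_graph i" by (auto simp: S_def)
  show "plane_graph H" using plane_double_star_graph[OF nar] i by simp
  show "double_star H" using ds i by simp
  show "verts H = verts (complete_graph (insert v0 (range q)))"
    using i by (simp add: double_star_graph_def complete_graph_def)
next
  define S where "S = double_star_graph ` {..<n}"
  have sub: "e \<subseteq> insert v0 (range q) \<and> card e = 2" if "e \<in> double_star_edges i" for e i
    using wf_double_star_graph[of i] that by (auto simp: wf_graph_def double_star_graph_def)
  have disj: "i = j" if "e \<in> double_star_edges i" "e \<in> double_star_edges j" for e i j
    using that(1) that(2) hull_edge_iff center_edge_iff unfolding double_star_edges_def[of i] by blast
  have cover: "\<exists>i<n. e \<in> double_star_edges i" if e: "e \<subseteq> insert v0 (range q)" "card e = 2" for e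
  proof -
    have tr: "tree_of x < n" "center_tree_of x < n" if "x < L" for x
      using that L n2 by (auto simp: tree_of_def center_tree_of_def)
    have hull: "\<exists>i<n. {q a, q b} \<in> double_star_edges i" if "a < b" "b < L" for a b
      using hull_edge_iff[OF that] tr[of "owner a b"] that by (auto simp: owner_def)
    have cen: "\<exists>i<n. {v0, q b} \<in> double_star_edges i" if "b < L" for b
      using center_edge_iff[OF that] tr that by auto
    obtain u w where uw: "e = {u, w}" "u \<noteq> w" using e by (auto simp: card_2_iff)
    then have "u \<in> insert v0 (range q)" "w \<in> insert v0 (range q)" using e by auto
    then show ?thesis
    proof (elim point_cases)
      fix a b assume ab: "a < L" "u = q a" "b < L" "w = q b"
      then show ?thesis using uw hull[of a b] hull[of b a] 
        by (metis insert_commute linorder_neqE_nat)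
    qed (use uw cen in \<open>auto simp: insert_commute\<close>)
  qed
  show "graph_partition (complete_graph (insert v0 (range q))) S"
    unfolding graph_partition_def
  proof (intro conjI ballI)
    fix H assume "H \<in> S"
    then obtain i where H: "H = double_star_graph i" by (auto simp: S_def)
    have "edges H \<subseteq> {e. e \<subseteq> insert v0 (range q) \<and> card e = 2}"
      using sub[of _ i] by (auto simp only: H double_star_graph_def graph.simps)
    then show "subgraph H (complete_graph (insert v0 (range q)))"
      using wf_double_star_graph[of i] by (simp add: H subgraph_def complete_graph_def double_star_graph_def)
  next
    show "pairwise (\<lambda>H H'. edges H \<inter> edges H' = {}) S"
      using disj by (auto simp: S_def pairwise_def double_star_graph_def)
    show "(\<Union>H\<in>S. verts H) = verts (complete_graph (insert v0 (range q)))"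
    proof -
      have "0 \<in> {..<n}" using n2 by simp
      then show ?thesis by (auto simp: S_def complete_graph_def double_star_graph_def)
    qed
    show "(\<Union>H\<in>S. edges H) = edges (complete_graph (insert v0 (range q)))"
    proof (intro equalityI subsetI)
      fix e assume "e \<in> edges (complete_graph (insert v0 (range q)))"
      then obtain i where "i < n" "e \<in> double_star_edges i"
        using cover by (auto simp: complete_graph_def)
      then show "e \<in> (\<Union>H\<in>S. edges H)" by (auto simp: S_def double_star_graph_def)
    qed (use sub in \<open>fastforce simp: S_def complete_graph_def double_star_graph_def\<close>)
  qed
qed

theorem partitionable_iff_window:
  "partitionable_into_plane_spanning_double_stars (complete_graph (insert v0 (range q))) \<longleftrightarrow>
   (\<exists>x. \<forall>j<n. \<not> narrow (x + j))"
proof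
  assume "\<exists>x. \<forall>j<n. \<not> narrow (x + j)"
  then obtain x where x: "\<And>j. j < n \<Longrightarrow> \<not> narrow (x + j)" by blast
  interpret sh: cyclic_points v0 "\<lambda>i. q (i + x)" "\<lambda>i. phi (i + x)" "\<lambda>i. rho (i + x)" n L
    by (rule cyclic_points_shift)
  have "\<not> sh.narrow j" if "j < n" for j
    using x[OF that] by (simp add: narrow_def sh.narrow_def ac_simps)
  from sh.window_imp_partitionable_aux[OF this]
  show "partitionable_into_plane_spanning_double_stars (complete_graph (insert v0 (range q)))"
    by (simp add: range_shift)
qed (rule partitionable_imp_window)

end

section \<open>Windows and families of groups\<close>

text \<open>The index of the first point of group \<open>g\<close> when the points are numbered
  group by group and the groups repeat periodically.\<close>

definition cyclic_prefix_sum :: "nat list \<Rightarrow> nat \<Rightarrow> nat" where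
  "cyclic_prefix_sum N g = (\<Sum>j<g. N ! (j mod length N))"

lemma cyclic_prefix_sum_length: "cyclic_prefix_sum N (g + length N) = cyclic_prefix_sum N g + sum_list N"
proof (induction g)
  case 0
  show ?case by (simp add: cyclic_prefix_sum_def sum_list_sum_nth atLeast0LessThan)
qed (simp add: cyclic_prefix_sum_def)

lemma cyclic_prefix_sum_add_mult:
  "cyclic_prefix_sum N (g + length N * t) = cyclic_prefix_sum N g + sum_list N * t"
proof (induction t)
  case (Suc t)
  then show ?case using cyclic_prefix_sum_length[of N "g + length N * t"] by (simp add: ac_simps)
qed simp

text \<open>
  The points are indexed group by group, periodically, and \<open>gamma i\<close> is the group of the
  point \<open>i\<close>, where groups \<open>g\<close> and \<open>g + k\<close> are the same.
\<close>

lemma add_mod_cancel: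
  fixes h i j k :: nat
  assumes "(h + i) mod k = (h + j) mod k"
  shows "i mod k = j mod k"
  using assms
proof (induction i j rule: linorder_wlog)
  case (le i j)
  then have "(h + j) mod k = (h + i) mod k" "h + i \<le> h + j" by auto
  then have "k dvd h + j - (h + i)" using mod_eq_dvd_iff_nat by blast
  then have "j mod k = i mod k" using le mod_eq_dvd_iff_nat by auto
  then show ?case by simp
qed simp

locale cyclic_groups =
  fixes N :: "nat list" and k m n L :: nat and gamma :: "nat \<Rightarrow> nat"
  assumes k: "k = length N" and km: "k = 2 * m + 1" and m1: "m \<ge> 1"
    and N1: "i < k \<Longrightarrow> N ! i \<ge> 1" and sumN: "sum_list N = L" and Ln: "L + 1 = 2 * n" and n_ge_2: "n \<ge> 2"
    and gamma_ge: "cyclic_prefix_sum N (gamma i) \<le> i"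
    and gamma_less: "i < cyclic_prefix_sum N (Suc (gamma i))"
begin

abbreviation C :: "nat \<Rightarrow> nat" where
  "C \<equiv> cyclic_prefix_sum N"

lemma C_Suc: "C g + 1 \<le> C (Suc g)"
  using N1[of "g mod k"] km by (simp add: cyclic_prefix_sum_def k)

lemma C_strict: "strict_mono C"
  using C_Suc by (intro strict_monoI_Suc) (metis Suc_eq_plus1 Suc_le_eq)

lemma C_mono: "g \<le> h \<Longrightarrow> C g \<le> C h"
  using C_strict by (simp add: strict_mono_less_eq)

lemma C_period: "C (g + k) = C g + L"
  using cyclic_prefix_sum_length[of N g] by (simp add: k sumN)

text \<open>A Galois connection: it translates between inequalities of groups and inequalities of
  point indices.\<close>

lemma le_gamma_iff: "g \<le> gamma i \<longleftrightarrow> C g \<le> i"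
proof
  assume "g \<le> gamma i"
  then show "C g \<le> i" using C_mono gamma_ge le_trans by blast
next
  assume "C g \<le> i"
  then have "C g < C (Suc (gamma i))" using gamma_less le_less_trans by blast
  then show "g \<le> gamma i" using C_strict by (simp add: strict_mono_less)
qed

lemma gamma_le_iff: "gamma i \<le> g \<longleftrightarrow> i < C (Suc g)"
  using le_gamma_iff[of "Suc g" i] by linarith

lemma gamma_period: "gamma (i + L) = gamma i + k"
proof (rule antisym)
  show "gamma (i + L) \<le> gamma i + k"
    using gamma_less[of i] C_period[of "Suc (gamma i)"] by (simp add: gamma_le_iff)
  show "gamma i + k \<le> gamma (i + L)"
    using gamma_ge[of i] C_period[of "gamma i"] by (simp add: le_gamma_iff)
qed

section \<open>Narrow indices and small families, in terms of groups only\<close>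

definition close_groups :: "nat \<Rightarrow> bool" where
  "close_groups i \<longleftrightarrow> gamma (i + n) \<le> gamma i + m"

definition small_family :: "nat \<Rightarrow> bool" where
  "small_family h \<longleftrightarrow> C (h + m) - C h \<le> n - 2"

lemma small_family_iff: "small_family h \<longleftrightarrow> C (h + m) + 2 \<le> C h + n"
  using n_ge_2 C_mono[of h "h + m"] by (auto simp: small_family_def)

lemma small_family_add: "small_family (h + k) \<longleftrightarrow> small_family h"
  using C_period[of h] C_period[of "h + m"] by (simp add: small_family_def ac_simps)

lemma small_family_mod: "small_family (h mod k) \<longleftrightarrow> small_family h"
proof -
  have "small_family (j + k * t) \<longleftrightarrow> small_family j" for j t
  proof (induction t)
    case (Suc t)
    then show ?case using small_family_add[of "j + k * t"] by (simp add: ac_simps)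
  qed simp
  from this[of "h mod k" "h div k"] show ?thesis by simp
qed

lemma close_groups_period: "close_groups (i + L) \<longleftrightarrow> close_groups i"
  using gamma_period[of i] gamma_period[of "i + n"] by (simp add: close_groups_def ac_simps)

text \<open>The points \<open>i\<close> to \<open>i + n\<close> stay within \<open>m + 1\<close>
  groups. The \<open>m\<close> groups that complete the turn keep at most
  \<open>L - (n + 1) = n - 2\<close> points.\<close>

lemma close_groups_imp_small:
  assumes "close_groups i"
  shows "small_family (gamma i + m + 1)"
proof -
  have "i + n < C (gamma i + m + 1)" using assms by (simp add: close_groups_def gamma_le_iff)
  moreover have "C (gamma i + m + 1 + m) = C (gamma i) + L"
  proof -
    have eq: "gamma i + m + 1 + m = gamma i + k" using km by simp
    show ?thesis unfolding eq by (rule C_period)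
  qed
  ultimately show ?thesis using gamma_ge[of i] Ln by (simp add: small_family_iff)
qed

lemma covered_by_small:
  assumes win: "\<And>x. \<exists>j<n. close_groups (x + j)" and g: "g \<ge> 2 * k"
  obtains h where "small_family h" "h \<le> g" "g < h + m"
proof -
  define a where "a = g - 2 * m"
  have a: "a \<ge> k" "g = a + 2 * m" using g km by (auto simp: a_def)
  \<comment> \<open>The bound \<open>g \<ge> 2 * k\<close> ensures that subtracting \<open>n\<close>
    is not truncated.\<close>
  have "C (a + m) \<ge> C k" using a by (intro C_mono) auto
  moreover have "C k \<ge> n" using C_period[of 0] Ln n_ge_2 by (simp add: cyclic_prefix_sum_def)
  ultimately have Cn: "C (a + m) \<ge> n" by simp
  obtain j where j: "j < n" "close_groups (C (a + m) - n + j)" using win by blast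
  define i where "i = C (a + m) - n + j"
  have i: "i < C (a + m)" "C (a + m) \<le> i + n" using Cn j by (auto simp: i_def)
  have "a \<le> gamma i"
  proof -
    have "a + m \<le> gamma (i + n)" using i le_gamma_iff by blast
    then show ?thesis using j(2) by (simp add: close_groups_def i_def)
  qed
  moreover have "gamma i < a + m" using i le_gamma_iff[of "a + m" i] by linarith
  moreover have "small_family (gamma i + m + 1)" using j(2) close_groups_imp_small by (simp add: i_def)
  ultimately show ?thesis using a by (intro that) auto
qed

lemma three_small_families:
  assumes win: "\<And>x. \<exists>j<n. close_groups (x + j)"
  obtains h1 h2 h3 where "small_family h1" "small_family h2" "small_family h3"
    "h1 < h2" "h2 \<le> h1 + m" "h2 < h3" "h3 \<le> h2 + m" "h1 + k \<le> h3 + m"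
proof -
  note cov = covered_by_small[OF win]
  \<comment> \<open>The greedy step: a small family must contain group \<open>h + m\<close>, the
    first one after family \<open>h\<close>, and the latest admissible start is taken.\<close>
  have next_ex: "\<exists>h'. small_family h' \<and> h < h' \<and> h' \<le> h + m \<and> (\<forall>z. small_family z \<and> z \<le> h + m \<longrightarrow> z \<le> h')"
    if h: "h \<ge> 2 * k" for h
  proof -
    obtain z where z: "small_family z" "z \<le> h + m" "h + m < z + m" using cov[of "h + m"] h by auto
    define h' where "h' = Max {z. small_family z \<and> z \<le> h + m}"
    have fin: "finite {z. small_family z \<and> z \<le> h + m}" by simp
    have "h' \<in> {z. small_family z \<and> z \<le> h + m}"
      unfolding h'_def using z fin by (intro Max_in) auto
    moreover have le: "y \<le> h'" if "small_family y" "y \<le> h + m" for y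
      unfolding h'_def using that fin by (intro Max_ge) auto
    moreover have "h < h'" using le[OF z(1,2)] z(3) by simp
    ultimately show ?thesis by blast
  qed
  \<comment> \<open>Starting at \<open>3 * k\<close> gives \<open>h1 > 3 * k - m\<close>, far enough
    for \<open>covered_by_small\<close> to apply again.\<close>
  have "2 * k \<le> 3 * k" by simp
  from cov[OF this] obtain h1 where "small_family h1" "3 * k < h1 + m" by blast
  then have h1: "small_family h1" "h1 \<ge> 2 * k" using km by linarith+
  obtain h2 where h2: "small_family h2" "h1 < h2" "h2 \<le> h1 + m"
    "\<And>z. small_family z \<Longrightarrow> z \<le> h1 + m \<Longrightarrow> z \<le> h2"
    using next_ex[OF h1(2)] by blast
  obtain h3 where h3: "small_family h3" "h2 < h3" "h3 \<le> h2 + m"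
    using next_ex[of h2] h1 h2(2) by (meson le_less_trans less_imp_le)
  \<comment> \<open>By the maximality of \<open>h2\<close>, a later small start lies beyond
    \<open>h1 + m\<close>. So \<open>h3 + m\<close> is at least
    \<open>h1 + 2 * m + 1 = h1 + k\<close>, and the turn is complete.\<close>
  have "h3 > h1 + m" using h2(4)[OF h3(1)] h3(2) by linarith
  then have "h1 + k \<le> h3 + m" using km by linarith
  then show ?thesis using that h1(1) h2(1-3) h3 by blast
qed

text \<open>As \<open>m < k\<close>, the residues are distinct and the sum runs through consecutive
  terms of the prefix sum.\<close>

lemma sum_family: "(\<Sum>i\<in>{(h + i) mod k | i. i < m}. N ! i) = C (h + m) - C h"
proof -
  have "inj_on (\<lambda>i. (h + i) mod k) {..<m}"
  proof (rule inj_onI)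
    fix i j assume ij: "i \<in> {..<m}" "j \<in> {..<m}" "(h + i) mod k = (h + j) mod k"
    then have "i mod k = j mod k" using add_mod_cancel by blast
    then show "i = j" using ij km by simp
  qed
  then have "(\<Sum>i\<in>(\<lambda>i. (h + i) mod k) ` {..<m}. N ! i) = (\<Sum>i<m. N ! ((h + i) mod k))"
    by (simp add: sum.reindex)
  moreover have "{(h + i) mod k | i. i < m} = (\<lambda>i. (h + i) mod k) ` {..<m}" by auto
  moreover have "C (h + t) = C h + (\<Sum>i<t. N ! ((h + i) mod k))" for t
    by (induction t) (auto simp: cyclic_prefix_sum_def k)
  ultimately show ?thesis by simp
qed

text \<open>The small family is the one that contains group \<open>g - m\<close>, where
  \<open>g\<close> is the group of the last index of the window. The \<open>m + 1\<close> groups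
  \<open>h + m\<close> to \<open>h + 2 * m\<close> after it hold at least \<open>n + 1\<close>
  points, and \<open>i\<close> is the first index of the window in these groups.\<close>

lemma three_families_imp_window:
  assumes fam: "\<And>r. r < k \<Longrightarrow> \<exists>h t. small_family h \<and> t < m \<and> r = (h + t) mod k"
  shows "\<exists>j<n. close_groups (x + j)"
proof -
  \<comment> \<open>One turn is added so that \<open>g \<ge> k\<close> and \<open>g - m - t\<close>
    is not truncated.\<close>
  define y where "y = x + L"
  define g where "g = gamma (y + n - 1)"
  have "k \<le> g"
  proof -
    have "C k = L" using C_period[of 0] by (simp add: cyclic_prefix_sum_def)
    then show ?thesis unfolding g_def le_gamma_iff using n_ge_2 by (simp add: y_def)
  qed
  obtain h0 t where ht: "small_family h0" "t < m" "(g - m) mod k = (h0 + t) mod k"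
    using fam[of "(g - m) mod k"] km by auto
  define h where "h = g - m - t"
  have h: "h + t = g - m" "h + t + m = g" using \<open>k \<le> g\<close> ht(2) km by (auto simp: h_def)
  have "(h + t) mod k = (h0 + t) mod k" using ht h by simp
  then have "h mod k = h0 mod k" 
    using add_mod_cancel[of t h k h0] by (simp add: add.commute)
  then have small: "C (h + m) + 2 \<le> C h + n"
    using ht(1) small_family_mod[of h] small_family_mod[of h0] small_family_iff by simp
  define i where "i = max y (C (h + m))"
  have "C (h + m) \<le> C g" using h by (intro C_mono) simp
  then have iy: "y \<le> i" "i < y + n"
    using gamma_ge[of "y + n - 1"] n_ge_2 by (auto simp: i_def g_def)
  have C2: "C (h + 2 * m + 1) = C h + L" using C_period[of h] km by (simp add: ac_simps)
  \<comment> \<open>Handles the case \<open>i = y\<close>: since \<open>t < m\<close>, group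
    \<open>g + 1\<close> is still at most \<open>h + 2 * m\<close>. In the case
    \<open>i = C (h + m)\<close> the smallness of the family gives the bound.\<close>
  have "y + n < C (h + 2 * m + 1)"
  proof -
    have "y + n - 1 < C (Suc g)" using gamma_less by (simp add: g_def)
    also have "C (Suc g) + 1 \<le> C (Suc (Suc g))" by (rule C_Suc)
    also have "C (Suc (Suc g)) \<le> C (h + 2 * m + 1)" using h ht(2) by (intro C_mono) simp
    finally show ?thesis by simp
  qed
  then have "i + n < C (Suc (h + 2 * m))" using C2 small Ln by (auto simp: i_def)
  then have "gamma (i + n) \<le> h + 2 * m" by (simp add: gamma_le_iff)
  moreover have "h + m \<le> gamma i" by (simp add: le_gamma_iff i_def)
  ultimately have "close_groups i" by (simp add: close_groups_def)
  moreover have "i = (x + (i - y)) + L" using iy by (simp add: y_def)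
  ultimately have "close_groups (x + (i - y))" using close_groups_period by metis
  then show ?thesis using iy by (intro exI[of _ "i - y"]) auto
qed

theorem windows_iff_three_families:
  "(\<forall>x. \<exists>j<n. close_groups (x + j)) \<longleftrightarrow>
   (\<exists>F1 F2 F3. distinct [F1, F2, F3] \<and>
      (\<forall>F\<in>{F1, F2, F3}. consecutive_family k F \<and> (\<Sum>i\<in>F. N ! i) \<le> n - 2) \<and>
      F1 \<union> F2 \<union> F3 = {..<k})" (is "?W \<longleftrightarrow> ?F")
proof -
  define fam where "fam = (\<lambda>h. {(h + i) mod k | i. i < m})"
  have m: "(k - 1) div 2 = m" using km by simp
  have fam_sub: "fam h \<subseteq> {..<k}" for h using km by (auto simp: fam_def)
  have fam_card: "finite (fam h)" "card (fam h) \<le> m" for h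
  proof -
    have "fam h = (\<lambda>i. (h + i) mod k) ` {..<m}" by (auto simp: fam_def)
    then show "finite (fam h)" "card (fam h) \<le> m" using card_image_le[of "{..<m}"] by auto
  qed
  have dir1: ?F if W: ?W
  proof -
    from W obtain h1 h2 h3 where h: "small_family h1" "small_family h2" "small_family h3"
      "h1 < h2" "h2 \<le> h1 + m" "h2 < h3" "h3 \<le> h2 + m" "h1 + k \<le> h3 + m"
      using three_small_families by blast
    have cover: "fam h1 \<union> fam h2 \<union> fam h3 = {..<k}"
    proof
      show "{..<k} \<subseteq> fam h1 \<union> fam h2 \<union> fam h3"
      proof
        fix r assume "r \<in> {..<k}"
        then have r: "r < k" by simp
        \<comment> \<open>The representative of the residue \<open>r\<close> in the turn that starts
          at \<open>h1\<close>; the summand \<open>k * h1\<close> prevents truncation.\<close>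
        define g where "g = h1 + (r + k * h1 - h1) mod k"
        have "g mod k = (h1 + (r + k * h1 - h1)) mod k" by (simp add: g_def mod_add_right_eq)
        also have "h1 + (r + k * h1 - h1) = r + k * h1" using km by simp
        finally have gr: "g mod k = r" using r by simp
        have g: "h1 \<le> g" "g < h1 + k" using km by (auto simp: g_def)
        have fam_in: "r \<in> fam h" if "h \<le> g" "g < h + m" for h
        proof -
          have "r = (h + (g - h)) mod k" "g - h < m" using that gr by auto
          then show ?thesis unfolding fam_def by blast
        qed
        consider "g < h1 + m" | "h2 \<le> g" "g < h2 + m" | "h3 \<le> g" "g < h3 + m" using g h by linarith
        then show "r \<in> fam h1 \<union> fam h2 \<union> fam h3" by cases (use fam_in g in auto)
      qed
    qed (use fam_sub in auto)
    \<comment> \<open>Two families hold at most \<open>2 * m < k\<close> groups, so three covering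
      families are pairwise different.\<close>
    have no2: "{..<k} \<noteq> fam a \<union> fam b" for a b
    proof
      assume "{..<k} = fam a \<union> fam b"
      then have "card {..<k} \<le> card (fam a) + card (fam b)" using card_Un_le by metis
      then show False using fam_card(2)[of a] fam_card(2)[of b] km by simp
    qed
    have dist: "distinct [fam h1, fam h2, fam h3]"
      using no2[of h1 h3] no2[of h1 h2] cover by auto
    have cf: "consecutive_family k (fam h)" for h
    proof -
      have "fam h = fam (h mod k)" by (simp add: fam_def mod_add_left_eq)
      then show ?thesis unfolding consecutive_family_def m fam_def 
        using km by (intro exI[of _ "h mod k"]) auto
    qed
    have small: "(\<Sum>i\<in>fam h. N ! i) \<le> n - 2" if "small_family h" for h
      using that sum_family[of h] by (simp add: fam_def small_family_def)
    have all: "\<forall>F\<in>{fam h1, fam h2, fam h3}. consecutive_family k F \<and> (\<Sum>i\<in>F. N ! i) \<le> n - 2"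
      using cf small[OF h(1)] small[OF h(2)] small[OF h(3)] by blast
    show ?thesis
    proof (intro exI)
      show "distinct [fam h1, fam h2, fam h3] \<and>
        (\<forall>F\<in>{fam h1, fam h2, fam h3}. consecutive_family k F \<and> (\<Sum>i\<in>F. N ! i) \<le> n - 2) \<and>
        fam h1 \<union> fam h2 \<union> fam h3 = {..<k}"
        by (rule conjI[OF dist conjI[OF all cover]])
    qed
  qed
  have dir2: ?W if F: "\<forall>F\<in>{F1, F2, F3}. consecutive_family k F \<and> (\<Sum>i\<in>F. N ! i) \<le> n - 2"
      "F1 \<union> F2 \<union> F3 = {..<k}" for F1 F2 F3
  proof -
    have "\<exists>h t. small_family h \<and> t < m \<and> r = (h + t) mod k" if r: "r < k" for r
    proof -
      obtain F' where F': "F' \<in> {F1, F2, F3}" "r \<in> F'" using F(2) r by blast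
      then have F1: "consecutive_family k F'" "(\<Sum>i\<in>F'. N ! i) \<le> n - 2" using F(1) by blast+
      then obtain h where h: "F' = fam h" unfolding consecutive_family_def m fam_def by blast
      then have "small_family h" using F1(2) sum_family[of h] by (simp add: fam_def small_family_def)
      then show ?thesis using F'(2) h by (auto simp: fam_def)
    qed
    then show ?thesis using three_families_imp_window by blast
  qed
  show ?thesis
  proof
    assume ?F
    then show ?W by (elim exE conjE) (rule dir2)
  qed (rule dir1)
qed

end

section \<open>From wheels to indexed points\<close>

text \<open>Division by \<open>of_real r * cis \<psi>\<close> moves the polygon vertex to 1, where
  \<open>Arg\<close> is continuous. Hence one bound serves all angles and centers; the minimum with
  1 keeps \<open>w\<close> away from 0.\<close>

lemma polar_near_circle:
  assumes "r > 0" "\<eta> > 0"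
  obtains \<epsilon> where "\<epsilon> > 0"
    "\<And>p v \<psi>. dist p (v + of_real r * cis \<psi>) < \<epsilon> \<Longrightarrow>
       \<exists>\<rho> \<delta>. \<rho> > 0 \<and> \<bar>\<delta>\<bar> < \<eta> \<and> p = v + of_real \<rho> * cis (\<psi> + \<delta>)"
proof -
  have "continuous (at (1 :: complex)) Arg" by (rule continuous_at_Arg) auto
  then obtain d where d: "d > 0" "\<And>w. dist w 1 < d \<Longrightarrow> dist (Arg w) (Arg 1) < \<eta>"
    using assms(2) unfolding continuous_at_eps_delta by metis
  show ?thesis
  proof (rule that[of "r * min d 1"])
    show "r * min d 1 > 0" using assms d by simp
    fix p v \<psi> assume close: "dist p (v + of_real r * cis \<psi>) < r * min d 1"
    define w where "w = (p - v) / (of_real r * cis \<psi>)"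
    have p: "p = v + of_real r * cis \<psi> * w" using assms by (simp add: w_def)
    have "p - (v + of_real r * cis \<psi>) = of_real r * cis \<psi> * (w - 1)"
      by (subst p) (simp add: algebra_simps)
    then have "r * norm (w - 1) < r * min d 1"
      using close assms by (simp add: dist_norm norm_mult)
    then have w: "norm (w - 1) < min d 1" using assms by simp
    then have "w \<noteq> 0" by auto
    have "of_real r * cis \<psi> * w = of_real r * cis \<psi> * (of_real (norm w) * cis (Arg w))"
      by (rule arg_cong) (simp add: rcis_cmod_Arg[unfolded rcis_def])
    also have "\<dots> = of_real (r * norm w) * cis (\<psi> + Arg w)"
      by (simp add: cis_mult[symmetric] mult_ac)
    finally have "p = v + of_real (r * norm w) * cis (\<psi> + Arg w)" using p by simp
    moreover have "\<bar>Arg w\<bar> < \<eta>" using d(2)[of w] w by (simp add: dist_norm)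
    moreover have "r * norm w > 0" using assms \<open>w \<noteq> 0\<close> by simp
    ultimately show "\<exists>\<rho> \<delta>. \<rho> > 0 \<and> \<bar>\<delta>\<bar> < \<eta> \<and> p = v + of_real \<rho> * cis (\<psi> + \<delta>)" by blast
  qed
qed

lemma collinear_real_multiple:
  fixes v p q :: complex
  assumes "q - v = of_real c * (p - v)"
  shows "collinear {v, p, q}"
proof -
  have "collinear {0, p - v, q - v}"
    unfolding collinear_lemma using assms by (metis scaleR_conv_of_real)
  then have "collinear {p, v, q}" by (subst collinear_3) auto
  then show ?thesis by (simp add: insert_commute)
qed

text \<open>The bound on \<open>\<delta>\<close> makes the sectors of different groups disjoint, so
  sorting by angle sorts by group; its exact size is the one needed in
  \<open>narrow_iff\<close>.\<close>

locale wheel_points =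
  fixes N :: "nat list" and k m n L :: nat and v0 :: complex and \<theta> :: real
    and Q :: "complex set" and g :: "complex \<Rightarrow> nat" and \<rho> \<delta> :: "complex \<Rightarrow> real"
  assumes k: "k = length N" and km: "k = 2 * m + 1" and m1: "m \<ge> 1"
    and N1: "i < k \<Longrightarrow> N ! i \<ge> 1" and sumN: "sum_list N = L" and Ln: "L + 1 = 2 * n" and n_ge_2: "n \<ge> 2"
    and fin_Q: "finite Q" and g_less: "p \<in> Q \<Longrightarrow> g p < k"
    and card_g: "j < k \<Longrightarrow> card {p \<in> Q. g p = j} = N ! j"
    and polar_Q: "p \<in> Q \<Longrightarrow> p = v0 + of_real (\<rho> p) * cis (\<theta> + 2 * pi * real (g p) / real k + \<delta> p)"
    and \<rho>_pos: "p \<in> Q \<Longrightarrow> \<rho> p > 0" and \<delta>_small: "p \<in> Q \<Longrightarrow> \<bar>\<delta> p\<bar> < pi / (2 * real k)"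
    and gen: "general_position (insert v0 Q)" and v0_notin: "v0 \<notin> Q"
    and conv: "convex_position Q" and v0_hull: "v0 \<in> convex hull Q"
begin

definition ang :: "complex \<Rightarrow> real" where
  "ang p = 2 * pi * real (g p) / real k + \<delta> p"

lemma k_pos: "real k > 0"
  using km by simp

lemma ang_scaled:
  assumes "p \<in> Q"
  shows "2 * pi * real (g p) - pi / 2 < real k * ang p" "real k * ang p < 2 * pi * real (g p) + pi / 2"
proof -
  have "\<bar>real k * \<delta> p\<bar> < pi / 2"
    using \<delta>_small[OF assms] k_pos by (simp add: abs_mult field_simps)
  moreover have "real k * ang p = 2 * pi * real (g p) + real k * \<delta> p"
    using k_pos by (simp add: ang_def field_simps)
  ultimately show "2 * pi * real (g p) - pi / 2 < real k * ang p"
    "real k * ang p < 2 * pi * real (g p) + pi / 2" by linarith+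
qed

lemma polar_ang: "p \<in> Q \<Longrightarrow> p = v0 + of_real (\<rho> p) * cis (\<theta> + ang p)"
  using polar_Q[of p] by (simp add: ang_def add.assoc)

lemma not_collinear:
  assumes "p \<in> Q" "p' \<in> Q" "p \<noteq> p'"
  shows "\<not> collinear {v0, p, p'}"
proof -
  have "v0 \<noteq> p" "v0 \<noteq> p'" using assms v0_notin by blast+
  then have "card {v0, p, p'} = 3" using assms(3) by simp
  moreover have "{v0, p, p'} \<subseteq> insert v0 Q" using assms by auto
  ultimately show ?thesis using gen by (simp add: general_position_def)
qed

text \<open>Two points on a common line through \<open>v0\<close> contradict general position. The
  case \<open>s = 1\<close> excludes equal angles, \<open>s = -1\<close> excludes opposite
  ones.\<close>

lemma ang_ne:
  assumes "p \<in> Q" "p' \<in> Q" "p \<noteq> p'" and eq: "cis (\<theta> + ang p') = of_real s * cis (\<theta> + ang p)"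
  shows False
proof -
  have p: "p - v0 = of_real (\<rho> p) * cis (\<theta> + ang p)"
    using polar_ang[OF assms(1)] by (metis add_diff_cancel_left')
  have "p' - v0 = of_real (\<rho> p') * cis (\<theta> + ang p')"
    using polar_ang[OF assms(2)] by (metis add_diff_cancel_left')
  also have "\<dots> = of_real (\<rho> p' * s / \<rho> p) * (p - v0)"
    unfolding p eq using \<rho>_pos[OF assms(1)] by simp
  finally have "p' - v0 = of_real (\<rho> p' * s / \<rho> p) * (p - v0)" .
  then show False using collinear_real_multiple not_collinear[OF assms(1-3)] by blast
qed

lemma inj_on_ang: "inj_on ang Q"
proof (rule inj_onI)
  fix p p' assume "p \<in> Q" "p' \<in> Q" "ang p = ang p'"
  then show "p = p'" using ang_ne[of p p' 1] by auto
qed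

lemma g_mono:
  assumes "p \<in> Q" "p' \<in> Q" "ang p < ang p'"
  shows "g p \<le> g p'"
proof (rule ccontr)
  assume "\<not> ?thesis"
  then have "real (g p) \<ge> real (g p') + 1" by linarith
  then have "2 * pi * real (g p) \<ge> 2 * pi * (real (g p') + 1)" by simp
  moreover have "real k * ang p < real k * ang p'" using assms k_pos by simp
  ultimately show False
    using ang_scaled[OF assms(1)] ang_scaled[OF assms(2)] pi_gt_zero by (simp add: algebra_simps)
qed

lemma ang_spread:
  assumes "p \<in> Q" "p' \<in> Q"
  shows "ang p < ang p' + 2 * pi"
proof -
  have "real (g p) + 1 \<le> real k" using g_less[OF assms(1)] by linarith
  then have "2 * pi * (real (g p) + 1) \<le> 2 * pi * real k" by (intro mult_left_mono) auto
  moreover have "2 * pi * real (g p') \<ge> 0" by simp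
  ultimately have "real k * ang p < real k * ang p' + 2 * pi * real k"
    using ang_scaled(2)[OF assms(1)] ang_scaled(1)[OF assms(2)] pi_gt_zero by (simp only: distrib_left)
  then have "real k * ang p < real k * (ang p' + 2 * pi)" by (simp add: algebra_simps)
  then show ?thesis using k_pos by simp
qed

lemma card_g_less: "c \<le> k \<Longrightarrow> card {p \<in> Q. g p < c} = cyclic_prefix_sum N c"
proof (induction c)
  case 0
  show ?case by (simp add: cyclic_prefix_sum_def)
next
  case (Suc c)
  have "{p \<in> Q. g p < Suc c} = {p \<in> Q. g p < c} \<union> {p \<in> Q. g p = c}" by auto
  then have "card {p \<in> Q. g p < Suc c} = card {p \<in> Q. g p < c} + card {p \<in> Q. g p = c}"
    using fin_Q by (simp add: card_Un_disjoint disjoint_iff)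
  then show ?case using Suc card_g[of c] by (simp add: cyclic_prefix_sum_def k)
qed

lemma card_Q: "card Q = L"
proof -
  have "{p \<in> Q. g p < k} = Q" using g_less by auto
  then show ?thesis
    using card_g_less[of k] cyclic_prefix_sum_length[of N 0] k sumN by (simp add: cyclic_prefix_sum_def)
qed

section \<open>Numbering the hull points by angle\<close>

definition pt :: "nat \<Rightarrow> complex" where
  "pt i = inv_into Q ang (sorted_list_of_set (ang ` Q) ! i)"

lemma length_angs: "length (sorted_list_of_set (ang ` Q)) = L"
  using card_Q by (simp add: card_image[OF inj_on_ang])

lemma pt_props:
  assumes "i < L"
  shows "pt i \<in> Q" "ang (pt i) = sorted_list_of_set (ang ` Q) ! i"
proof -
  have "sorted_list_of_set (ang ` Q) ! i \<in> ang ` Q"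
    using nth_mem[of i "sorted_list_of_set (ang ` Q)"] assms length_angs fin_Q by simp
  then show "pt i \<in> Q" "ang (pt i) = sorted_list_of_set (ang ` Q) ! i"
    unfolding pt_def by (auto intro: inv_into_into f_inv_into_f)
qed

lemma ang_pt_mono:
  assumes "i < j" "j < L"
  shows "ang (pt i) < ang (pt j)"
  using strict_sorted_list_of_set[of "ang ` Q"] assms pt_props length_angs
  by (auto simp: strict_sorted_iff sorted_wrt_iff_nth_less)

lemma pt_surj: "pt ` {..<L} = Q"
proof
  show "Q \<subseteq> pt ` {..<L}"
  proof
    fix p assume p: "p \<in> Q"
    then have "ang p \<in> set (sorted_list_of_set (ang ` Q))" using fin_Q by simp
    then obtain i where i: "i < L" "sorted_list_of_set (ang ` Q) ! i = ang p"
      using length_angs by (auto simp: in_set_conv_nth)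
    then have "pt i = p" using p by (simp add: pt_def inv_into_f_f[OF inj_on_ang])
    then show "p \<in> pt ` {..<L}" using i by auto
  qed
qed (use pt_props in auto)

lemma inj_on_pt: "inj_on pt {..<L}"
  by (rule eq_card_imp_inj_on) (simp_all add: pt_surj card_Q)

lemma L_pos: "L > 0"
  using Ln n_ge_2 by simp

definition q :: "nat \<Rightarrow> complex" where
  "q i = pt (i mod L)"

definition phi :: "nat \<Rightarrow> real" where
  "phi i = \<theta> + ang (q i) + 2 * pi * real (i div L)"

definition gamma :: "nat \<Rightarrow> nat" where
  "gamma i = g (q i) + k * (i div L)"

lemma q_in: "q i \<in> Q"
  using pt_props L_pos by (simp add: q_def)

lemma range_q: "range q = Q"
proof
  show "Q \<subseteq> range q"
  proof
    fix p assume "p \<in> Q"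
    then obtain i where "i < L" "p = pt i" using pt_surj by blast
    then have "p = q i" by (simp add: q_def)
    then show "p \<in> range q" by simp
  qed
qed (use q_in in auto)

lemma q_eq_iff: "q i = q j \<longleftrightarrow> i mod L = j mod L"
  using inj_onD[OF inj_on_pt, of "i mod L" "j mod L"] L_pos by (auto simp: q_def)

lemma phi_mono:
  assumes "i < j"
  shows "phi i < phi j"
proof (cases "i div L = j div L")
  case True
  then have "i mod L < j mod L"
    using assms by (metis add_less_cancel_left div_mult_mod_eq)
  then show ?thesis using ang_pt_mono[of "i mod L" "j mod L"] L_pos True by (simp add: phi_def q_def)
next
  case False
  then have "i div L < j div L" using assms div_le_mono[of i j L] by simp
  then have "real (i div L) + 1 \<le> real (j div L)" by linarith
  then have "2 * pi * (real (i div L) + 1) \<le> 2 * pi * real (j div L)" by (intro mult_left_mono) auto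
  then show ?thesis
    using ang_spread[OF q_in[of i] q_in[of j]] by (simp add: phi_def algebra_simps)
qed

lemma cis_phi: "cis (phi i) = cis (\<theta> + ang (q i))"
proof -
  have "cis (phi i) = cis (\<theta> + ang (q i)) * cis (2 * pi * real (i div L))"
    unfolding phi_def cis_mult ..
  also have "cis (2 * pi * real (i div L)) = 1" by (intro cis_multiple_2pi) auto
  finally show ?thesis by simp
qed

lemma phi_ne_pi: "phi j - phi i \<noteq> pi"
proof
  assume "phi j - phi i = pi"
  then have "phi j = phi i + pi" by simp
  then have "cis (phi j) = - cis (phi i)" by (simp add: complex_eq_iff)
  then have eq: "cis (\<theta> + ang (q j)) = of_real (-1) * cis (\<theta> + ang (q i))"
    by (simp add: cis_phi)
  show False
  proof (cases "q i = q j")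
    case True
    then show False using eq cis_neq_zero[of "\<theta> + ang (q i)"] by simp
  next
    case False
    then show False using ang_ne[OF q_in q_in _ eq] by simp
  qed
qed

lemma q_outside:
  assumes "i < j" "j < l" "l < i + L"
  shows "q j \<notin> convex hull {v0, q i, q l}"
proof
  assume j: "q j \<in> convex hull {v0, q i, q l}"
  have ne: "q i \<noteq> q j" "q l \<noteq> q j"
  proof -
    have "a mod L \<noteq> b mod L" if "a < b" "b < a + L" for a b
    proof
      assume "a mod L = b mod L"
      then have "L dvd b - a" using that mod_eq_dvd_iff_nat[of a b L] by auto
      then show False using that by (auto dest: dvd_imp_le)
    qed
    from this[of i j] this[of j l] show "q i \<noteq> q j" "q l \<noteq> q j" using assms by (auto simp: q_eq_iff)
  qed
  have "convex hull {v0, q i, q l} \<subseteq> convex hull (insert v0 (Q - {q j}))"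
    using ne q_in by (intro hull_mono) auto
  moreover have "insert (q j) (Q - {q j}) = Q" using q_in by auto
  moreover have "v0 \<noteq> q j" using v0_notin q_in by metis
  ultimately have "q j \<in> convex hull (Q - {q j})"
    using convex_hull_anti_exchange[of v0 "q j" "Q - {q j}"] v0_hull j by auto
  then show False using conv q_in by (auto simp: convex_position_def)
qed

sublocale pts: cyclic_points v0 q phi "\<lambda>i. \<rho> (q i)" n L
proof unfold_locales
  show "q (i + L) = q i" for i by (simp add: q_def)
  show "phi (i + L) = phi i + 2 * pi" for i using L_pos by (simp add: phi_def q_def algebra_simps)
  show "q i = v0 + of_real (\<rho> (q i)) * cis (phi i)" for i
    using polar_ang[OF q_in] by (simp add: cis_phi)
qed (use n_ge_2 Ln phi_mono \<rho>_pos q_in phi_ne_pi q_outside in auto)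

text \<open>Points are sorted by angle and hence by group, so the indices with group below
  \<open>c\<close> form an initial segment, whose length is the number of such points.\<close>

lemma g_less_iff:
  assumes "i < L" "c \<le> k"
  shows "g (pt i) < c \<longleftrightarrow> i < cyclic_prefix_sum N c"
proof -
  define I where "I = {i. i < L \<and> g (pt i) < c}"
  have down: "i \<in> I" if "j \<in> I" "i \<le> j" for i j
    using that g_mono[of "pt i" "pt j"] pt_props ang_pt_mono[of i j]
    by (cases "i = j") (auto simp: I_def)
  have "pt ` I = {p \<in> Q. g p < c}" unfolding I_def using pt_surj by auto
  moreover have "inj_on pt I" by (rule inj_on_subset[OF inj_on_pt]) (auto simp: I_def)
  ultimately have card: "card I = cyclic_prefix_sum N c"
    using card_g_less[OF assms(2)] card_image by metis
  have fin: "finite I" by (simp add: I_def)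
  have "I = {..<card I}"
  proof (rule card_subset_eq[symmetric])
    show "{..<card I} \<subseteq> I"
    proof
      fix j assume j: "j \<in> {..<card I}"
      show "j \<in> I"
      proof (rule ccontr)
        assume "j \<notin> I"
        then have "I \<subseteq> {..<j}" using down by (meson lessThan_iff not_le subsetI)
        then have "card I \<le> j" using card_mono[of "{..<j}" I] by simp
        then show False using j by simp
      qed
    qed
  qed (use fin in auto)
  then show ?thesis using assms card by (auto simp: I_def)
qed

lemma gamma_bounds:
  "cyclic_prefix_sum N (gamma i) \<le> i" "i < cyclic_prefix_sum N (Suc (gamma i))"
proof -
  define a where "a = i mod L"
  have a: "a < L" "q i = pt a" "i = a + L * (i div L)" using L_pos by (auto simp: a_def q_def)
  have gk: "g (pt a) < k" using g_less pt_props a by simp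
  have C: "cyclic_prefix_sum N (b + k * t) = cyclic_prefix_sum N b + L * t" for b t
    using cyclic_prefix_sum_add_mult[of N b t] by (simp add: k sumN)
  have "cyclic_prefix_sum N (g (pt a)) \<le> a" using g_less_iff[OF a(1), of "g (pt a)"] gk by simp
  then show "cyclic_prefix_sum N (gamma i) \<le> i" 
    using C[of "g (pt a)" "i div L"] a by (simp add: gamma_def)
  have "a < cyclic_prefix_sum N (Suc (g (pt a)))" using g_less_iff[OF a(1), of "Suc (g (pt a))"] gk by simp
  then show "i < cyclic_prefix_sum N (Suc (gamma i))" 
    using C[of "Suc (g (pt a))" "i div L"] a by (simp add: gamma_def)
qed

sublocale grp: cyclic_groups N k m n L gamma
  by unfold_locales (use k km m1 N1 sumN Ln n_ge_2 gamma_bounds in auto)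

lemma phi_scaled:
  "\<bar>real k * (phi i - \<theta>) - 2 * pi * real (gamma i)\<bar> < pi / 2"
proof -
  have "real k * (phi i - \<theta>) - 2 * pi * real (gamma i) = real k * ang (q i) - 2 * pi * real (g (q i))"
    by (simp add: phi_def gamma_def algebra_simps)
  then show ?thesis using ang_scaled[OF q_in[of i]] by linarith
qed

text \<open>After scaling by \<open>k\<close>, each angle is within pi/2 of 2 pi times its group, so
  a difference of angles is off by less than pi. The threshold \<open>k * pi\<close> lies exactly
  midway between \<open>2 * pi * m\<close> and \<open>2 * pi * (m + 1)\<close>, so the group
  difference decides.\<close>

lemma narrow_iff: "pts.narrow i \<longleftrightarrow> grp.close_groups i"
proof -
  define D where "D = real k * (phi (i + n) - phi i) - 2 * pi * (real (gamma (i + n)) - real (gamma i))"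
  have D: "\<bar>D\<bar> < pi"
  proof -
    have "D = (real k * (phi (i + n) - \<theta>) - 2 * pi * real (gamma (i + n))) -
        (real k * (phi i - \<theta>) - 2 * pi * real (gamma i))" by (simp add: D_def algebra_simps)
    then show ?thesis using phi_scaled[of i] phi_scaled[of "i + n"] by linarith
  qed
  have kpi: "real k * pi = 2 * pi * real m + pi" using km by (simp add: algebra_simps)
  have nar: "pts.narrow i \<longleftrightarrow> real k * (phi (i + n) - phi i) < real k * pi"
    using k_pos by (simp add: pts.narrow_def)
  show ?thesis
  proof (cases "gamma (i + n) \<le> gamma i + m")
    case True
    then have "real (gamma (i + n)) - real (gamma i) \<le> real m" by linarith
    then have "2 * pi * (real (gamma (i + n)) - real (gamma i)) \<le> 2 * pi * real m"
      by (intro mult_left_mono) auto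
    then have "real k * (phi (i + n) - phi i) < real k * pi" using D kpi unfolding D_def by linarith
    then show ?thesis using True nar by (simp add: grp.close_groups_def)
  next
    case False
    then have "real (gamma (i + n)) - real (gamma i) \<ge> real m + 1" by linarith
    then have "2 * pi * (real (gamma (i + n)) - real (gamma i)) \<ge> 2 * pi * (real m + 1)"
      by (intro mult_left_mono) auto
    then have "real k * (phi (i + n) - phi i) > real k * pi" using D kpi unfolding D_def distrib_left by linarith
    then show ?thesis using False nar by (simp add: grp.close_groups_def)
  qed
qed

lemma not_partitionable_iff:
  "\<not> partitionable_into_plane_spanning_double_stars (complete_graph (insert v0 Q)) \<longleftrightarrow>
   (\<exists>F1 F2 F3. distinct [F1, F2, F3] \<and>
      (\<forall>F\<in>{F1, F2, F3}. consecutive_family k F \<and> (\<Sum>i\<in>F. N ! i) \<le> n - 2) \<and>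
      F1 \<union> F2 \<union> F3 = {..<k})"
  unfolding grp.windows_iff_three_families[symmetric]
  using pts.partitionable_iff_window unfolding range_q narrow_iff by blast

end

section \<open>Generalized wheels as instances of the indexed setting\<close>

lemma wheel_center_in_hull:
  assumes "finite Q" "insert v0 Q \<inter> interior (convex hull (insert v0 Q)) = {v0 :: complex}"
  shows "v0 \<in> convex hull Q"
proof (rule ccontr)
  assume "v0 \<notin> convex hull Q"
  then have "v0 extreme_point_of convex hull (insert v0 Q)"
    using assms(1) by (rule extreme_point_of_convex_hull_insert[rotated])
  then have "v0 \<notin> interior (convex hull (insert v0 Q))" by (rule extreme_point_not_in_interior)
  then show False using assms(2) by blast
qed

theorem theorem4:
  fixes N :: "nat list" and k n :: nat and v0 :: complex and r \<theta> :: real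
  assumes "k = length N" and "k \<ge> 3" and "odd k"
    and "\<forall>i<k. N ! i \<ge> 1"
    and "odd (sum_list N)"
    and "2 * n = 1 + sum_list N"
    and "r > 0"
  shows "\<forall>\<^sub>F \<epsilon> in at_right 0. \<forall>K. generalized_wheel N v0 r \<theta> \<epsilon> K \<longrightarrow>
           (\<not> partitionable_into_plane_spanning_double_stars K \<longleftrightarrow>
            (\<exists>F1 F2 F3. distinct [F1, F2, F3] \<and>
               (\<forall>F\<in>{F1, F2, F3}. consecutive_family k F \<and> (\<Sum>i\<in>F. N ! i) \<le> n - 2) \<and>
               F1 \<union> F2 \<union> F3 = {..<k}))"
proof -
  obtain m where m: "k = 2 * m + 1" using assms(3) by (elim oddE)
  have "k \<le> sum_list N"
  proof -
    have "(\<Sum>i<k. 1) \<le> (\<Sum>i<k. N ! i)" using assms(4) by (intro sum_mono) auto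
    then show ?thesis using assms(1) by (simp add: sum_list_sum_nth atLeast0LessThan)
  qed
  then have n2: "n \<ge> 2" using assms by simp
  have "pi / (2 * real k) > 0" using assms(2) by simp
  then obtain \<epsilon>0 where \<epsilon>0: "\<epsilon>0 > 0"
    "\<And>p v \<psi>. dist p (v + of_real r * cis \<psi>) < \<epsilon>0 \<Longrightarrow>
       \<exists>\<rho> \<delta>. \<rho> > 0 \<and> \<bar>\<delta>\<bar> < pi / (2 * real k) \<and> p = v + of_real \<rho> * cis (\<psi> + \<delta>)"
    by (rule polar_near_circle[OF assms(7)]) blast
  show ?thesis
  \<comment> \<open>The threshold depends only on \<open>r\<close> and \<open>k\<close>, so it is
    uniform over all admissible placements of the groups.\<close>
  proof (rule eventually_at_rightI[of 0 \<epsilon>0], intro allI impI)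
    fix \<epsilon> K assume \<epsilon>: "\<epsilon> \<in> {0<..<\<epsilon>0}" and K: "generalized_wheel N v0 r \<theta> \<epsilon> K"
    obtain G where wg: "wheel_groups N v0 r \<theta> \<epsilon> G"
      and K_eq: "K = complete_graph (insert v0 (\<Union>i<length N. G i))"
      using K by (auto simp: generalized_wheel_def)
    define Q where "Q = (\<Union>i<k. G i)"
    have G: "\<And>i. i < k \<Longrightarrow> finite (G i) \<and> card (G i) = N ! i"
        "\<And>i p. i < k \<Longrightarrow> p \<in> G i \<Longrightarrow> dist p (v0 + of_real r * cis (\<theta> + 2 * pi * real i / real k)) < \<epsilon>"
      and disj: "disjoint_family_on G {..<k}"
      and Q: "v0 \<notin> Q" "general_position (insert v0 Q)" "convex_position Q"
        "insert v0 Q \<inter> interior (convex hull (insert v0 Q)) = {v0}"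
      using wg by (auto simp: wheel_groups_def Let_def Q_def assms(1))
    have "\<exists>i \<rho> \<delta>. i < k \<and> p \<in> G i \<and> \<rho> > 0 \<and> \<bar>\<delta>\<bar> < pi / (2 * real k) \<and>
        p = v0 + of_real \<rho> * cis (\<theta> + 2 * pi * real i / real k + \<delta>)" if p: "p \<in> Q" for p
    proof -
      obtain i where i: "i < k" "p \<in> G i" using p by (auto simp: Q_def)
      then have "dist p (v0 + of_real r * cis (\<theta> + 2 * pi * real i / real k)) < \<epsilon>0"
        using G(2)[OF i] \<epsilon> by simp
      then show ?thesis using \<epsilon>0(2) i by blast
    qed
    then obtain g \<rho> \<delta> where gp: "\<And>p. p \<in> Q \<Longrightarrow> g p < k \<and> p \<in> G (g p) \<and> \<rho> p > 0 \<and>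
        \<bar>\<delta> p\<bar> < pi / (2 * real k) \<and>
        p = v0 + of_real (\<rho> p) * cis (\<theta> + 2 * pi * real (g p) / real k + \<delta> p)"
      by metis
    \<comment> \<open>\<open>g p\<close> was chosen as some group that contains \<open>p\<close>;
      disjointness of the groups makes it the only one.\<close>
    have fib: "{p \<in> Q. g p = j} = G j" if j: "j < k" for j
    proof
      show "{p \<in> Q. g p = j} \<subseteq> G j" using gp by auto
      show "G j \<subseteq> {p \<in> Q. g p = j}"
      proof
        fix p assume p: "p \<in> G j"
        then have pQ: "p \<in> Q" using j by (auto simp: Q_def)
        have "g p = j"
        proof (rule ccontr)
          assume "g p \<noteq> j"
          then have "G (g p) \<inter> G j = {}" using disj gp[OF pQ] j by (simp add: disjoint_family_on_def)
          then show False using gp[OF pQ] p by auto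
        qed
        then show "p \<in> {p \<in> Q. g p = j}" using pQ by simp
      qed
    qed
    have finQ: "finite Q" using G(1) by (auto simp: Q_def)
    interpret wheel_points N k m n "sum_list N" v0 \<theta> Q g \<rho> \<delta>
    proof unfold_locales
      show "m \<ge> 1" using assms(2) m by simp
      show "v0 \<in> convex hull Q" by (rule wheel_center_in_hull[OF finQ Q(4)])
      show "card {p \<in> Q. g p = j} = N ! j" if "j < k" for j using fib[OF that] G(1)[OF that] by simp
      show "p = v0 + of_real (\<rho> p) * cis (\<theta> + 2 * pi * real (g p) / real k + \<delta> p)" if "p \<in> Q" for p
        using gp[OF that] by blast
    qed (use assms(1,4,6) m n2 finQ gp Q(1-3) in auto)
    have "K = complete_graph (insert v0 Q)" by (simp add: K_eq Q_def assms(1))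
    then show "\<not> partitionable_into_plane_spanning_double_stars K \<longleftrightarrow>
        (\<exists>F1 F2 F3. distinct [F1, F2, F3] \<and>
           (\<forall>F\<in>{F1, F2, F3}. consecutive_family k F \<and> (\<Sum>i\<in>F. N ! i) \<le> n - 2) \<and>
           F1 \<union> F2 \<union> F3 = {..<k})"
      using not_partitionable_iff by simp
  qed (rule \<epsilon>0(1))
qed

end
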